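(* Let $E$ be a closed environment in a pure type system with generative definitions satisfying the standing assumptions (P1)–(P4) below. Then $E$ is consistent, i.e. there is no term $e$ such that $E \vdash e : \Pi x{:}\star.\, x$.
   Context: Setting (pure type system with generative definitions). Fix a PTS specification: a set $\mathcal{S}$ of sorts, axioms $\mathcal{A}\subseteq\mathcal{S}\times\mathcal{S}$ and rules $\subseteq \mathcal{S}^3$. Pseudoterms: $t ::= v \mid s \mid t\,t \mid \lambda v{:}t.t \mid \Pi v{:}t.t$ ($v$ a variable, $s$ a sort). An environment is a finite sequence of declarations, each being (i) a variable declaration $v:t$; (ii) an inductive definition $\mathrm{Ind}(\Gamma^I:=\Gamma^C)$, where $\Gamma^I=I_1:t^I_1;\dots;I_n:t^I_n$ declares inductive types with $t^I_j$ of the form $\Pi\vec{(z{:}Z_j)}\,s'_j$ ($s'_j$ a sort) and $\Gamma^C=c_1:t^C_1;\dots;c_m:t^C_m$ declares constructors with $t^C_i$ of the form $\Pi\vec{(z{:}Z'_i)}\,I_{j_i}\vec w$; or (iii) a definition by rewriting $\mathrm{Rew}(\Gamma,R)$, where $\Gamma=f_1:t_1;\dots;f_n:t_n$ declares function symbols and $R$ is a finite set of rewrite rules $\Delta\vdash l\longrightarrow r$ with $\Delta$ a list of variable declarations and $l,r$ pseudoterms. Inductive types, constructors and function symbols are called constants; if a constant $h$ has declared type $\Pi x_1{:}t_1\dots\Pi x_n{:}t_n.\hat t$ with $\hat t$ not a product, $n$ is its arity and $h(e_1,\dots,e_n)$ denotes $h$ applied to $e_1,\dots,e_n$. Typing judgments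 $E\vdash \mathrm{ok}$, $E\vdash e:t$ are those of the PTS extended so that constants have their declared types; the conversion rule uses the congruence $\approx$ on well-typed terms generated by $\longrightarrow$, the union of $\beta$-reduction and rewriting ($E\vdash l\delta\longrightarrow r\delta$ whenever $\Delta\vdash l\longrightarrow r$ is a rule of a rewrite definition in $E$ and $\delta$ is a well-typed substitution, i.e. $E\vdash v\delta:t\delta$ for all $v:t\in\Delta$). Inductive definitions must satisfy a fixed positivity condition Pos and rewrite definitions a fixed acceptance condition Acc. Standing assumptions: (P1) subject reduction, (P2) uniqueness of types up to $\approx$, (P3) strong normalization of well-typed terms in correct environments, (P4) confluence of $\longrightarrow$ on well-typed terms. $t{\downarrow}$ denotes the normal form of $t$. The sort $\star$ is the sort of propositions (as in the calculus of constructions, $(\star,\square)\in\mathcal{A}$), and the inductive definition $\mathrm{Ind}(\mathrm{False}:\star:=)$ with no constructors is accepted by Pos in every correct environment. Canonical terms: given $E\vdash e:t$, $e$ is canonical iff, whenever $t{\downarrow}$ is an inductive type applied to arguments, $e=c(e_1,\dots,e_k)$ for a constructor $c$ and canonical $e_1,\dots,e_k$ (otherwise $e$ is arbitrary); a substitution $\delta:\Delta\to E$ is canonical if $x\delta$ is canonical for each $x\in\Delta$. Given $E\vdash\mathrm{Rew}(\Gamma,R):\mathrm{correct}$ and $f:\Pi x_1{:}t_1\dots\Pi x_n{:}t_n.t\in\Gamma$: a goal is a well-typed sequent $E;\Gamma;\Delta\vdash f(e_1,\dots,e_n)$ (where $\Gamma$ is used as plain variable declarations); a normalized canonical instance of it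 is any well-typed sequent $E;\mathrm{Rew}(\Gamma,R);E'\vdash f(e_1\delta{\downarrow},\dots,e_n\delta{\downarrow})$ for an environment $E'$ and a canonical well-typed substitution $\delta:\Delta\to E;\mathrm{Rew}(\Gamma,R);E'$. A term $e$ is immediately covered by $R$ if $l\gamma=e$ (up to $\alpha$) for some rule $G\vdash l\longrightarrow r\in R$ and substitution $\gamma$; a goal is covered if all its normalized canonical instances are immediately covered. $\mathrm{Rew}(\Gamma,R)$ is complete in $E$ if for every $f:\Pi x_1{:}t_1\dots\Pi x_n{:}t_n.t\in\Gamma$ the goal $E;\Gamma;x_1:t_1;\dots;x_n:t_n\vdash f(x_1,\dots,x_n)$ is covered by $R$. An environment $E$ is closed iff it contains only inductive definitions and definitions by rewriting, and for each decomposition $E=E_1;\mathrm{Rew}(\Gamma,R);E_2$, $\mathrm{Rew}(\Gamma,R)$ is complete in $E_1$.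
   Formalization: "Immediately covered" is taken with a well-typed substitution γ from the rule's context, and each left-hand side in Rew(Γ,R) must be headed by a function symbol of Γ; without either condition, closed environments satisfying (P1)–(P4) can be inconsistent. *)

theory Defs
  imports "HOL-Library.Infinite_Typeclass"
begin

section \<open>Pseudoterms\<close>

text \<open>
  Locally nameless syntax: bound variables are de Bruijn indices, everything declared in an
  environment (variables, inductive types, constructors, function symbols) is a name from one
  common supply.  Hence \<open>\<alpha>\<close>-equivalent pseudoterms are equal, and a declared
  function symbol can also be used as a plain variable declaration.  In \<open>Lam A b\<close> and
  \<open>Pi A B\<close> the index 0 is bound in \<open>b\<close> and \<open>B\<close>.
\<close>

datatype ('v, 's) pterm =
    Var 'v
  | Bound nat
  | Sort 's
  | App "('v, 's) pterm" "('v, 's) pterm"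
  | Lam "('v, 's) pterm" "('v, 's) pterm"
  | Pi "('v, 's) pterm" "('v, 's) pterm"

primrec open_at :: "nat \<Rightarrow> ('v, 's) pterm \<Rightarrow> ('v, 's) pterm \<Rightarrow> ('v, 's) pterm" where
  "open_at k u (Var x) = Var x"
| "open_at k u (Bound i) = (if i = k then u else Bound i)"
| "open_at k u (Sort s) = Sort s"
| "open_at k u (App a b) = App (open_at k u a) (open_at k u b)"
| "open_at k u (Lam A b) = Lam (open_at k u A) (open_at (Suc k) u b)"
| "open_at k u (Pi A B) = Pi (open_at k u A) (open_at (Suc k) u B)"

abbreviation inst :: "('v, 's) pterm \<Rightarrow> ('v, 's) pterm \<Rightarrow> ('v, 's) pterm" where
  "inst b u \<equiv> open_at 0 u b"

text \<open>\<open>lc_at 0 t\<close>: no dangling index in \<open>t\<close>.\<close>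

primrec lc_at :: "nat \<Rightarrow> ('v, 's) pterm \<Rightarrow> bool" where
  "lc_at k (Var x) \<longleftrightarrow> True"
| "lc_at k (Bound i) \<longleftrightarrow> i < k"
| "lc_at k (Sort s) \<longleftrightarrow> True"
| "lc_at k (App a b) \<longleftrightarrow> lc_at k a \<and> lc_at k b"
| "lc_at k (Lam A b) \<longleftrightarrow> lc_at k A \<and> lc_at (Suc k) b"
| "lc_at k (Pi A B) \<longleftrightarrow> lc_at k A \<and> lc_at (Suc k) B"

primrec fv :: "('v, 's) pterm \<Rightarrow> 'v set" where
  "fv (Var x) = {x}"
| "fv (Bound i) = {}"
| "fv (Sort s) = {}"
| "fv (App a b) = fv a \<union> fv b"
| "fv (Lam A b) = fv A \<union> fv b"
| "fv (Pi A B) = fv A \<union> fv B"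

text \<open>
  Simultaneous substitution of names.  It is only used for substitutions with locally closed
  images, so nothing can be captured.
\<close>

primrec subst :: "('v \<Rightarrow> ('v, 's) pterm) \<Rightarrow> ('v, 's) pterm \<Rightarrow> ('v, 's) pterm" where
  "subst \<sigma> (Var x) = \<sigma> x"
| "subst \<sigma> (Bound i) = Bound i"
| "subst \<sigma> (Sort s) = Sort s"
| "subst \<sigma> (App a b) = App (subst \<sigma> a) (subst \<sigma> b)"
| "subst \<sigma> (Lam A b) = Lam (subst \<sigma> A) (subst \<sigma> b)"
| "subst \<sigma> (Pi A B) = Pi (subst \<sigma> A) (subst \<sigma> B)"

abbreviation apps :: "('v, 's) pterm \<Rightarrow> ('v, 's) pterm list \<Rightarrow> ('v, 's) pterm" where
  "apps h es \<equiv> foldl App h es"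

fun head :: "('v, 's) pterm \<Rightarrow> ('v, 's) pterm" where
  "head (App a b) = head a"
| "head t = t"

fun arity :: "('v, 's) pterm \<Rightarrow> nat" where
  "arity (Pi A B) = Suc (arity B)"
| "arity t = 0"

fun target :: "('v, 's) pterm \<Rightarrow> ('v, 's) pterm" where
  "target (Pi A B) = target B"
| "target t = t"


section \<open>Environments\<close>

text \<open>Leftmost declarations come first, in contexts as well as in environments.\<close>

type_synonym ('v, 's) ctx = "('v \<times> ('v, 's) pterm) list"

text \<open>\<open>(\<Delta>, l, r)\<close> stands for \<open>\<Delta> \<turnstile> l \<longrightarrow> r\<close>.\<close>

type_synonym ('v, 's) rule = "('v, 's) ctx \<times> ('v, 's) pterm \<times> ('v, 's) pterm"

datatype ('v, 's) decl =
    VarD 'v "('v, 's) pterm"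
  | Ind "('v, 's) ctx" "('v, 's) ctx"
  | Rew "('v, 's) ctx" "('v, 's) rule set"

type_synonym ('v, 's) env = "('v, 's) decl list"

abbreviation vars :: "('v, 's) ctx \<Rightarrow> ('v, 's) env" where
  "vars \<Gamma> \<equiv> map (\<lambda>(x, t). VarD x t) \<Gamma>"

abbreviation names :: "('v, 's) ctx \<Rightarrow> 'v set" where
  "names \<Gamma> \<equiv> fst ` set \<Gamma>"

fun declared :: "('v, 's) decl \<Rightarrow> ('v, 's) ctx" where
  "declared (VarD x t) = [(x, t)]"
| "declared (Ind \<Gamma>I \<Gamma>C) = \<Gamma>I @ \<Gamma>C"
| "declared (Rew \<Gamma> R) = \<Gamma>"

definition env_names :: "('v, 's) env \<Rightarrow> 'v set" where
  "env_names E = (\<Union>d\<in>set E. names (declared d))"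

definition inductive_types :: "('v, 's) env \<Rightarrow> 'v set" where
  "inductive_types E = {I. \<exists>\<Gamma>I \<Gamma>C. Ind \<Gamma>I \<Gamma>C \<in> set E \<and> I \<in> names \<Gamma>I}"

definition constructors :: "('v, 's) env \<Rightarrow> 'v set" where
  "constructors E = {c. \<exists>\<Gamma>I \<Gamma>C. Ind \<Gamma>I \<Gamma>C \<in> set E \<and> c \<in> names \<Gamma>C}"


section \<open>Typing\<close>

text \<open>
  The type \<open>'s\<close> is the set of sorts.  \<open>pos\<close> and \<open>acc\<close> are the positivity and the
  acceptance condition; both may depend on the environment in which a definition is made.
\<close>

record ('v, 's) gpts =
  sort_axioms :: "('s \<times> 's) set"
  sort_rules :: "('s \<times> 's \<times> 's) set"
  pos :: "('v, 's) env \<Rightarrow> ('v, 's) ctx \<Rightarrow> ('v, 's) ctx \<Rightarrow> bool"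
  acc :: "('v, 's) env \<Rightarrow> ('v, 's) ctx \<Rightarrow> ('v, 's) rule set \<Rightarrow> bool"

text \<open>
  Bodies of binders are opened with a fresh name, where ``fresh'' means outside some finite
  set \<open>L\<close>.

  Reduction \<open>step\<close> is the closure of \<open>\<beta>\<close> and of the rewrite rules under all term
  formers.  It depends on the environment, which is extended when a binder is crossed, because
  only well-typed instances of rewrite rules are reductions.  Conversion \<open>conv\<close> is the
  equivalence generated by reduction between well-typed terms.  It is reflexive on all terms,
  because a top sort such as \<open>\<box>\<close> has no type but still occurs as a type.

  In \<open>ok_ind\<close> and \<open>ok_rew\<close> the declared types are typed by some sort, as the judgment
  \<open>ok\<close> of the corresponding variable declarations says; this includes that the declared
  names are new and distinct.  A definition by rewriting defines the symbols it declares: the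
  head of each left-hand side is one of them.  All further restrictions on definitions belong
  to \<open>pos\<close> and \<open>acc\<close>.
\<close>

inductive
  ok :: "('v, 's) gpts \<Rightarrow> ('v, 's) env \<Rightarrow> bool" and
  typing :: "('v, 's) gpts \<Rightarrow> ('v, 's) env \<Rightarrow> ('v, 's) pterm \<Rightarrow> ('v, 's) pterm \<Rightarrow> bool" and
  step :: "('v, 's) gpts \<Rightarrow> ('v, 's) env \<Rightarrow> ('v, 's) pterm \<Rightarrow> ('v, 's) pterm \<Rightarrow> bool" and
  conv :: "('v, 's) gpts \<Rightarrow> ('v, 's) env \<Rightarrow> ('v, 's) pterm \<Rightarrow> ('v, 's) pterm \<Rightarrow> bool"
  for P :: "('v, 's) gpts"
where
  ok_empty: "ok P []"
| ok_var: "\<lbrakk>typing P E t (Sort s); x \<notin> env_names E\<rbrakk> \<Longrightarrow> ok P (E @ [VarD x t])"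
| ok_ind: "\<lbrakk>ok P (E @ vars \<Gamma>I @ vars \<Gamma>C);
            \<forall>(I, t)\<in>set \<Gamma>I. \<exists>s. target t = Sort s;
            \<forall>(c, t)\<in>set \<Gamma>C. \<exists>I\<in>names \<Gamma>I. head (target t) = Var I;
            pos P E \<Gamma>I \<Gamma>C\<rbrakk> \<Longrightarrow>
           ok P (E @ [Ind \<Gamma>I \<Gamma>C])"
| ok_rew: "\<lbrakk>ok P (E @ vars \<Gamma>); finite R;
            \<And>\<Delta> l r. (\<Delta>, l, r) \<in> R \<Longrightarrow> ok P (E @ vars \<Gamma> @ vars \<Delta>);
            \<forall>(\<Delta>, l, r)\<in>R. lc_at 0 l \<and> lc_at 0 r \<and>
              fv l \<union> fv r \<subseteq> env_names E \<union> names \<Gamma> \<union> names \<Delta> \<and>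
              (\<exists>f\<in>names \<Gamma>. head l = Var f);
            acc P E \<Gamma> R\<rbrakk> \<Longrightarrow>
           ok P (E @ [Rew \<Gamma> R])"

| ty_name: "\<lbrakk>ok P E; d \<in> set E; (x, t) \<in> set (declared d)\<rbrakk> \<Longrightarrow> typing P E (Var x) t"
| ty_sort: "\<lbrakk>ok P E; (s1, s2) \<in> sort_axioms P\<rbrakk> \<Longrightarrow> typing P E (Sort s1) (Sort s2)"
| ty_pi: "\<lbrakk>typing P E A (Sort s1); finite L;
           \<And>x. x \<notin> L \<Longrightarrow> typing P (E @ [VarD x A]) (inst B (Var x)) (Sort s2);
           (s1, s2, s3) \<in> sort_rules P\<rbrakk> \<Longrightarrow>
          typing P E (Pi A B) (Sort s3)"
| ty_lam: "\<lbrakk>typing P E (Pi A B) (Sort s); finite L;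
            \<And>x. x \<notin> L \<Longrightarrow> typing P (E @ [VarD x A]) (inst b (Var x)) (inst B (Var x))\<rbrakk> \<Longrightarrow>
           typing P E (Lam A b) (Pi A B)"
| ty_app: "\<lbrakk>typing P E a (Pi A B); typing P E b A\<rbrakk> \<Longrightarrow> typing P E (App a b) (inst B b)"
| ty_conv: "\<lbrakk>typing P E e t; typing P E t' (Sort s); conv P E t t'\<rbrakk> \<Longrightarrow> typing P E e t'"

| st_beta: "step P E (App (Lam A b) a) (inst b a)"
| st_rew: "\<lbrakk>Rew \<Gamma> R \<in> set E; (\<Delta>, l, r) \<in> R;
            \<And>x t. (x, t) \<in> set \<Delta> \<Longrightarrow> typing P E (\<delta> x) (subst \<delta> t);
            \<forall>x. x \<notin> names \<Delta> \<longrightarrow> \<delta> x = Var x\<rbrakk> \<Longrightarrow>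
           step P E (subst \<delta> l) (subst \<delta> r)"
| st_app1: "step P E a a' \<Longrightarrow> step P E (App a b) (App a' b)"
| st_app2: "step P E b b' \<Longrightarrow> step P E (App a b) (App a b')"
| st_lam1: "step P E A A' \<Longrightarrow> step P E (Lam A b) (Lam A' b)"
| st_lam2: "\<lbrakk>finite L;
             \<And>x. x \<notin> L \<Longrightarrow> step P (E @ [VarD x A]) (inst b (Var x)) (inst b' (Var x))\<rbrakk> \<Longrightarrow>
            step P E (Lam A b) (Lam A b')"
| st_pi1: "step P E A A' \<Longrightarrow> step P E (Pi A B) (Pi A' B)"
| st_pi2: "\<lbrakk>finite L;
            \<And>x. x \<notin> L \<Longrightarrow> step P (E @ [VarD x A]) (inst B (Var x)) (inst B' (Var x))\<rbrakk> \<Longrightarrow>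
           step P E (Pi A B) (Pi A B')"

| cv_refl: "conv P E a a"
| cv_step: "\<lbrakk>step P E a b; typing P E a t; typing P E b t'\<rbrakk> \<Longrightarrow> conv P E a b"
| cv_sym: "conv P E a b \<Longrightarrow> conv P E b a"
| cv_trans: "\<lbrakk>conv P E a b; conv P E b c\<rbrakk> \<Longrightarrow> conv P E a c"

definition well_typed :: "('v, 's) gpts \<Rightarrow> ('v, 's) env \<Rightarrow> ('v, 's) pterm \<Rightarrow> bool" where
  "well_typed P E e \<longleftrightarrow> (\<exists>t. typing P E e t)"

text \<open>Well-typed substitution \<open>\<delta> : \<Delta> \<rightarrow> E\<close>, the identity outside \<open>\<Delta>\<close>.\<close>

definition wt_subst ::
  "('v, 's) gpts \<Rightarrow> ('v, 's) env \<Rightarrow> ('v, 's) ctx \<Rightarrow> ('v \<Rightarrow> ('v, 's) pterm) \<Rightarrow> bool" where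
  "wt_subst P E \<Delta> \<delta> \<longleftrightarrow>
     (\<forall>(x, t)\<in>set \<Delta>. typing P E (\<delta> x) (subst \<delta> t)) \<and>
     (\<forall>x. x \<notin> names \<Delta> \<longrightarrow> \<delta> x = Var x)"

definition normal :: "('v, 's) gpts \<Rightarrow> ('v, 's) env \<Rightarrow> ('v, 's) pterm \<Rightarrow> bool" where
  "normal P E t \<longleftrightarrow> (\<nexists>u. step P E t u)"

text \<open>\<open>t\<down>\<close>; meaningful under strong normalization and confluence.\<close>

definition nf :: "('v, 's) gpts \<Rightarrow> ('v, 's) env \<Rightarrow> ('v, 's) pterm \<Rightarrow> ('v, 's) pterm" where
  "nf P E t = (THE u. (step P E)\<^sup>*\<^sup>* t u \<and> normal P E u)"


section \<open>Standing assumptions\<close>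

definition subject_reduction :: "('v, 's) gpts \<Rightarrow> bool" where
  "subject_reduction P \<longleftrightarrow>
     (\<forall>E e e' t. typing P E e t \<longrightarrow> step P E e e' \<longrightarrow> typing P E e' t)"

definition uniqueness_of_types :: "('v, 's) gpts \<Rightarrow> bool" where
  "uniqueness_of_types P \<longleftrightarrow>
     (\<forall>E e t t'. typing P E e t \<longrightarrow> typing P E e t' \<longrightarrow> conv P E t t')"

definition strong_normalization :: "('v, 's) gpts \<Rightarrow> bool" where
  "strong_normalization P \<longleftrightarrow>
     (\<forall>E e. ok P E \<longrightarrow> well_typed P E e \<longrightarrow> termip (step P E) e)"

definition confluence :: "('v, 's) gpts \<Rightarrow> bool" where
  "confluence P \<longleftrightarrow>
     (\<forall>E a b c. well_typed P E a \<longrightarrow> (step P E)\<^sup>*\<^sup>* a b \<longrightarrow> (step P E)\<^sup>*\<^sup>* a c \<longrightarrow>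
        (\<exists>d. (step P E)\<^sup>*\<^sup>* b d \<and> (step P E)\<^sup>*\<^sup>* c d))"


section \<open>Completeness of definitions by rewriting\<close>

definition inductive_app :: "('v, 's) env \<Rightarrow> ('v, 's) pterm \<Rightarrow> bool" where
  "inductive_app E t \<longleftrightarrow> (\<exists>I\<in>inductive_types E. head t = Var I)"

text \<open>
  \<open>canonical P E e t\<close>: given \<open>E \<turnstile> e : t\<close>, the term \<open>e\<close> is canonical.  The types of the
  arguments of a constructor are unique up to conversion, so it does not matter which ones
  are used.
\<close>

inductive canonical ::
  "('v, 's) gpts \<Rightarrow> ('v, 's) env \<Rightarrow> ('v, 's) pterm \<Rightarrow> ('v, 's) pterm \<Rightarrow> bool"
  for P E where
  canonical_constructor:
    "\<lbrakk>typing P E (apps (Var c) es) t; inductive_app E (nf P E t); c \<in> constructors E;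
      \<And>e. e \<in> set es \<Longrightarrow> \<exists>t'. canonical P E e t'\<rbrakk> \<Longrightarrow>
     canonical P E (apps (Var c) es) t"
| canonical_other:
    "\<lbrakk>typing P E e t; \<not> inductive_app E (nf P E t)\<rbrakk> \<Longrightarrow> canonical P E e t"

definition canonical_subst ::
  "('v, 's) gpts \<Rightarrow> ('v, 's) env \<Rightarrow> ('v, 's) ctx \<Rightarrow> ('v \<Rightarrow> ('v, 's) pterm) \<Rightarrow> bool" where
  "canonical_subst P E \<Delta> \<delta> \<longleftrightarrow>
     wt_subst P E \<Delta> \<delta> \<and> (\<forall>(x, t)\<in>set \<Delta>. canonical P E (\<delta> x) (subst \<delta> t))"

text \<open>
  The matching substitution is a substitution from the context of the rule into the
  environment of the instance, as in the definition of rewriting.  With an arbitrary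
  assignment instead, closed environments can be inconsistent: the rule
  \<open>x:Nat, A:\<star> \<turnstile> f x A \<longrightarrow> r\<close> would cover \<open>f true A\<close> for \<open>f : Bool \<rightarrow> \<Pi>A:\<star>. A\<close>, although
  \<open>f true A\<close> does not rewrite.
\<close>

definition immediately_covered ::
  "('v, 's) gpts \<Rightarrow> ('v, 's) env \<Rightarrow> ('v, 's) rule set \<Rightarrow> ('v, 's) pterm \<Rightarrow> bool" where
  "immediately_covered P E R e \<longleftrightarrow>
     (\<exists>(G, l, r)\<in>R. \<exists>\<gamma>. wt_subst P E G \<gamma> \<and> subst \<gamma> l = e)"

text \<open>The goal \<open>E; \<Gamma>; \<Delta> \<turnstile> f(es)\<close>, in which \<open>\<Gamma>\<close> consists of variable declarations.\<close>

definition goal ::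
  "('v, 's) gpts \<Rightarrow> ('v, 's) env \<Rightarrow> ('v, 's) ctx \<Rightarrow> ('v, 's) ctx \<Rightarrow> 'v \<Rightarrow> ('v, 's) pterm list \<Rightarrow> bool"
where
  "goal P E \<Gamma> \<Delta> f es \<longleftrightarrow>
     (\<exists>t. (f, t) \<in> set \<Gamma> \<and> length es = arity t) \<and>
     well_typed P (E @ vars \<Gamma> @ vars \<Delta>) (apps (Var f) es)"

text \<open>The sequent \<open>E; Rew(\<Gamma>,R); E' \<turnstile> e\<close> is a normalized canonical instance of the goal.\<close>

definition normalized_canonical_instance ::
  "('v, 's) gpts \<Rightarrow> ('v, 's) env \<Rightarrow> ('v, 's) ctx \<Rightarrow> ('v, 's) rule set \<Rightarrow> ('v, 's) ctx \<Rightarrow> 'v \<Rightarrow>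
   ('v, 's) pterm list \<Rightarrow> ('v, 's) env \<Rightarrow> ('v, 's) pterm \<Rightarrow> bool" where
  "normalized_canonical_instance P E \<Gamma> R \<Delta> f es E' e \<longleftrightarrow>
     (let F = E @ [Rew \<Gamma> R] @ E' in
      \<exists>\<delta>. canonical_subst P F \<Delta> \<delta> \<and>
          e = apps (Var f) (map (\<lambda>a. nf P F (subst \<delta> a)) es) \<and> well_typed P F e)"

definition covered ::
  "('v, 's) gpts \<Rightarrow> ('v, 's) env \<Rightarrow> ('v, 's) ctx \<Rightarrow> ('v, 's) rule set \<Rightarrow> ('v, 's) ctx \<Rightarrow> 'v \<Rightarrow>
   ('v, 's) pterm list \<Rightarrow> bool" where
  "covered P E \<Gamma> R \<Delta> f es \<longleftrightarrow>
     (\<forall>E' e. normalized_canonical_instance P E \<Gamma> R \<Delta> f es E' e \<longrightarrow>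
             immediately_covered P (E @ [Rew \<Gamma> R] @ E') R e)"

text \<open>
  \<open>telescope xs t\<close> is \<open>x\<^sub>1:t\<^sub>1, \<dots>, x\<^sub>n:t\<^sub>n\<close> when \<open>t\<close> is
  \<open>\<Pi>x\<^sub>1:t\<^sub>1 \<dots> \<Pi>x\<^sub>n:t\<^sub>n. t'\<close>, with the bound variables named by \<open>xs\<close>.
\<close>

fun telescope :: "'v list \<Rightarrow> ('v, 's) pterm \<Rightarrow> ('v, 's) ctx" where
  "telescope (x # xs) (Pi A B) = (x, A) # telescope xs (inst B (Var x))"
| "telescope xs t = []"

definition complete_rew ::
  "('v, 's) gpts \<Rightarrow> ('v, 's) env \<Rightarrow> ('v, 's) ctx \<Rightarrow> ('v, 's) rule set \<Rightarrow> bool" where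
  "complete_rew P E \<Gamma> R \<longleftrightarrow>
     (\<forall>(f, t)\<in>set \<Gamma>. \<forall>xs.
        distinct xs \<and> length xs = arity t \<and> set xs \<inter> (env_names E \<union> names \<Gamma>) = {} \<longrightarrow>
        goal P E \<Gamma> (telescope xs t) f (map Var xs) \<and>
        covered P E \<Gamma> R (telescope xs t) f (map Var xs))"

definition closed_env :: "('v, 's) gpts \<Rightarrow> ('v, 's) env \<Rightarrow> bool" where
  "closed_env P E \<longleftrightarrow>
     (\<forall>d\<in>set E. \<nexists>x t. d = VarD x t) \<and>
     (\<forall>E1 \<Gamma> R E2. E = E1 @ [Rew \<Gamma> R] @ E2 \<longrightarrow> complete_rew P E1 \<Gamma> R)"

definition consistent :: "('v, 's) gpts \<Rightarrow> 's \<Rightarrow> ('v, 's) env \<Rightarrow> bool" where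
  "consistent P star E \<longleftrightarrow> (\<nexists>e. typing P E e (Pi (Sort star) (Bound 0)))"

end

theory Submission
  imports Defs
begin

text \<open>
  If \<open>e : \<Pi>x:\<star>. x\<close> in \<open>E\<close>, then \<open>e False : False\<close> in the environment that extends \<open>E\<close> by an
  empty inductive type \<open>False\<close>, and this environment is still closed.  In a closed environment
  every typed normal term is canonical, by induction on its size: the arguments of a fully
  applied function symbol are canonical by induction, so completeness yields a rule that matches
  and the term is not normal; Lambdas, products, sorts, inductive types and partial applications
  have a type that is not convertible to an inductive type.  Hence the normal form of
  \<open>e False\<close> would start with a constructor of \<open>False\<close>.
\<close>

section \<open>Pseudoterms\<close>

text \<open>A rewrite step demands a typed substitution, typing uses conversion, and conversion uses
  steps. Weakening and substitution therefore cannot be settled for typing alone: typing, reduction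
  and conversion have to be carried through one induction, and rewrite rules must survive it.

  The assumptions (P1)-(P4) speak of typed terms only, while a top sort has no type. Types are
  compared by combining confluence with shapes that reduction preserves: a product stays a product,
  and a head that is a sort or a name not defined by rewriting stays fixed. This yields the needed
  part of product injectivity.

  Completeness of a definition quantifies over every environment that may follow it. So the instance
  can be taken in the whole environment, later definitions and the added \<open>False\<close>
  included. A new \<open>False\<close> is added because \<open>E\<close> need not contain an empty
  type, and its freshness makes the extension correct.\<close>

lemma lc_at_mono: "lc_at k t \<Longrightarrow> k \<le> k' \<Longrightarrow> lc_at k' t"
proof (induction t arbitrary: k k')
  case (Lam A b)
  then show ?case by (meson Suc_le_mono lc_at.simps(5))
next
  case (Pi A B)
  then show ?case by (meson Suc_le_mono lc_at.simps(6))
qed auto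

lemma open_at_lc: "lc_at k t \<Longrightarrow> open_at k u t = t"
  by (induction t arbitrary: k) auto

lemma lc_at_open_Var: "lc_at k (open_at k (Var x) t) \<Longrightarrow> lc_at (Suc k) t"
  by (induction t arbitrary: k) (auto split: if_splits)

lemma fv_open: "fv t \<subseteq> fv (open_at k u t)"
  by (induction t arbitrary: k) auto

lemma subst_Var [simp]: "subst Var t = t"
  by (induction t) auto

lemma subst_cong: "(\<And>x. x \<in> fv t \<Longrightarrow> \<sigma> x = \<tau> x) \<Longrightarrow> subst \<sigma> t = subst \<tau> t"
  by (induction t) auto

lemma subst_id: "(\<And>x. x \<in> fv t \<Longrightarrow> \<sigma> x = Var x) \<Longrightarrow> subst \<sigma> t = t"
  using subst_cong[of t \<sigma> Var] by simp

lemma subst_subst: "subst \<sigma> (subst \<tau> t) = subst (\<lambda>x. subst \<sigma> (\<tau> x)) t"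
  by (induction t) auto

lemma subst_open_at:
  "(\<And>x. x \<in> fv t \<Longrightarrow> lc_at 0 (\<sigma> x)) \<Longrightarrow>
     subst \<sigma> (open_at k u t) = open_at k (subst \<sigma> u) (subst \<sigma> t)"
  by (induction t arbitrary: k) (auto intro!: open_at_lc[symmetric] intro: lc_at_mono)

lemma subst_inst_fresh:
  assumes "\<And>x. lc_at 0 (\<sigma> x)" and "y \<notin> fv t"
  shows "subst (\<sigma>(y := Var y)) (inst t (Var y)) = inst (subst \<sigma> t) (Var y)"
proof -
  have "subst (\<sigma>(y := Var y)) t = subst \<sigma> t"
    using assms(2) by (intro subst_cong) auto
  with assms(1) show ?thesis by (subst subst_open_at) auto
qed

lemma finite_fv [simp]: "finite (fv t)"
  by (induction t) auto

lemma head_apps [simp]: "head (apps h es) = head h"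
  by (induction es arbitrary: h) auto

lemma head_subst: "head l = Var f \<Longrightarrow> \<delta> f = Var f \<Longrightarrow> head (subst \<delta> l) = Var f"
  by (induction l rule: head.induct) auto

lemma apps_head: "\<exists>es. e = apps (head e) es"
proof (induction e)
  case (App a b)
  then obtain es where "a = apps (head a) es" by blast
  then have "App a b = apps (head (App a b)) (es @ [b])" by simp
  then show ?case by blast
qed (auto intro: exI[of _ "[]"])

lemma head_not_App: "head e \<noteq> App a b"
  by (induction e) auto

lemma size_apps: "size h \<le> size (apps h es)"
proof (induction es arbitrary: h)
  case (Cons b es)
  have "size h \<le> size (App h b)" by simp
  also have "\<dots> \<le> size (apps (App h b) es)" by (rule Cons)
  finally show ?case by simp
qed simp

lemma size_arg: "e \<in> set es \<Longrightarrow> size e < size (apps h es)"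
proof (induction es arbitrary: h)
  case (Cons b es)
  show ?case
  proof (cases "e = b")
    case True
    then have "size e < size (App h b)" by simp
    also have "\<dots> \<le> size (apps (App h b) es)" by (rule size_apps)
    finally show ?thesis by simp
  next
    case False
    with Cons show ?thesis by simp
  qed
qed simp

text \<open>Only an inequality: opening may put a product in the place of a bound target.\<close>

lemma arity_open: "arity t \<le> arity (open_at k u t)"
  by (induction t arbitrary: k) auto

lemma arity_open_Var [simp]: "arity (open_at k (Var x) t) = arity t"
  by (induction t arbitrary: k) auto

lemma head_open: "head t = Sort s \<or> head t = Var x \<Longrightarrow> head (open_at k u t) = head t"
  by (induction t arbitrary: k) auto

text \<open>The hypothesis excludes a target headed by a bound variable, the only head that opening
  can replace.\<close>

lemma target_open:
  "head (target t) = Sort s \<or> head (target t) = Var x \<Longrightarrow>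
     head (target (open_at k u t)) = head (target t)"
  by (induction t arbitrary: k) (auto simp: head_open)

section \<open>Derivations and declared names\<close>

text \<open>Mutual induction cut down to one judgment: the other three carry a trivial predicate and
  contribute no induction hypothesis.\<close>

lemmas conv_induct = ok_typing_step_conv.inducts(4)
  [where ?P1.0 = "\<lambda>_. True" and ?P2.0 = "\<lambda>_ _ _. True" and ?P3.0 = "\<lambda>_ _ _. True",
   simplified, consumes 1, case_names refl step sym trans]

lemmas step_induct = ok_typing_step_conv.inducts(3)
  [where ?P1.0 = "\<lambda>_. True" and ?P2.0 = "\<lambda>_ _ _. True" and ?P4.0 = "\<lambda>_ _ _. True",
   simplified, consumes 1, case_names beta rew app1 app2 lam1 lam2 pi1 pi2]

lemmas typing_induct = ok_typing_step_conv.inducts(2)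
  [where ?P1.0 = "\<lambda>_. True" and ?P3.0 = "\<lambda>_ _ _. True" and ?P4.0 = "\<lambda>_ _ _. True",
   simplified, consumes 1, case_names name sort pi lam app conv]

lemma typing_ok: "typing P E e t \<Longrightarrow> ok P E"
  by (induction rule: typing_induct) auto

text \<open>In \<open>ok_var\<close> the shorter environment is correct only by way of a typing
  derivation in it. The mutual induction therefore passes \<open>Q E\<close> along typing judgments
  too.\<close>

lemma ok_induct [consumes 1, case_names empty var ind rew]:
  assumes "ok P E" "Q []"
    and "\<And>E t s x. \<lbrakk>Q E; typing P E t (Sort s); x \<notin> env_names E\<rbrakk> \<Longrightarrow> Q (E @ [VarD x t])"
    and "\<And>E \<Gamma>I \<Gamma>C. \<lbrakk>ok P (E @ vars \<Gamma>I @ vars \<Gamma>C); Q (E @ vars \<Gamma>I @ vars \<Gamma>C);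
            \<forall>(I, t)\<in>set \<Gamma>I. \<exists>s. target t = Sort s;
            \<forall>(c, t)\<in>set \<Gamma>C. \<exists>I\<in>names \<Gamma>I. head (target t) = Var I;
            pos P E \<Gamma>I \<Gamma>C\<rbrakk> \<Longrightarrow> Q (E @ [Ind \<Gamma>I \<Gamma>C])"
    and "\<And>E \<Gamma> R. \<lbrakk>ok P (E @ vars \<Gamma>); Q (E @ vars \<Gamma>); finite R;
            \<And>\<Delta> l r. (\<Delta>, l, r) \<in> R \<Longrightarrow> ok P (E @ vars \<Gamma> @ vars \<Delta>);
            \<And>\<Delta> l r. (\<Delta>, l, r) \<in> R \<Longrightarrow> Q (E @ vars \<Gamma> @ vars \<Delta>);
            \<forall>(\<Delta>, l, r)\<in>R. lc_at 0 l \<and> lc_at 0 r \<and>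
              fv l \<union> fv r \<subseteq> env_names E \<union> names \<Gamma> \<union> names \<Delta> \<and>
              (\<exists>f\<in>names \<Gamma>. head l = Var f);
            acc P E \<Gamma> R\<rbrakk> \<Longrightarrow> Q (E @ [Rew \<Gamma> R])"
  shows "Q E"
proof -
  have "ok P E \<Longrightarrow> Q E"
  proof (induction rule: ok_typing_step_conv.inducts(1)[where ?P1.0 = Q and
        ?P2.0 = "\<lambda>E e t. Q E" and ?P3.0 = "\<lambda>_ _ _. True" and ?P4.0 = "\<lambda>_ _ _. True"])
    case ok_var
    then show ?case by (blast intro: assms(3))
  next
    case ok_ind
    then show ?case by (intro assms(4)) assumption+
  next
    case ok_rew
    then show ?case by (intro assms(5)) assumption+
  qed (fact assms(2) | assumption | rule TrueI)+
  with assms(1) show ?thesis by blast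
qed

lemma env_names_simps [simp]:
  "env_names [] = {}"
  "env_names (d # E) = names (declared d) \<union> env_names E"
  "env_names (E @ F) = env_names E \<union> env_names F"
  "env_names (vars \<Gamma>) = names \<Gamma>"
  by (auto simp: env_names_def image_iff split_beta)

lemma finite_env_names [simp]: "finite (env_names E)"
  by (auto simp: env_names_def)

lemma declared_in_env_names: "d \<in> set E \<Longrightarrow> (x, t) \<in> set (declared d) \<Longrightarrow> x \<in> env_names E"
  by (force simp: env_names_def)

lemma typing_lc: "typing P E (e :: ('v::infinite, 's) pterm) t \<Longrightarrow> lc_at 0 e"
proof (induction rule: typing_induct)
  case (pi E A s1 L B s2 s3)
  obtain x where "x \<notin> L" using pi ex_new_if_finite infinite_UNIV by metis
  with pi show ?case by (auto dest: lc_at_open_Var)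
next
  case (lam E A B s L b)
  obtain x where "x \<notin> L" using lam ex_new_if_finite infinite_UNIV by metis
  with lam show ?case by (auto dest: lc_at_open_Var)
qed auto

section \<open>Generation\<close>

text \<open>Inversion of typing up to conversion: the premises of the last rule other than
  \<open>ty_conv\<close>, whose type is convertible to \<open>t\<close>. The trailing conversions
  collapse by \<open>cv_trans\<close>.\<close>

fun generation :: "('v, 's) gpts \<Rightarrow> ('v, 's) env \<Rightarrow> ('v, 's) pterm \<Rightarrow> ('v, 's) pterm \<Rightarrow> bool" where
  "generation P E (Var x) t \<longleftrightarrow> (\<exists>d\<in>set E. \<exists>t0. (x, t0) \<in> set (declared d) \<and> conv P E t0 t)"
| "generation P E (Bound i) t \<longleftrightarrow> False"
| "generation P E (Sort s) t \<longleftrightarrow> (\<exists>s'. conv P E (Sort s') t)"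
| "generation P E (App a b) t \<longleftrightarrow>
     (\<exists>A B. typing P E a (Pi A B) \<and> typing P E b A \<and> conv P E (inst B b) t)"
| "generation P E (Lam A b) t \<longleftrightarrow>
     (\<exists>B s L. typing P E (Pi A B) (Sort s) \<and> finite L \<and>
       (\<forall>x. x \<notin> L \<longrightarrow> typing P (E @ [VarD x A]) (inst b (Var x)) (inst B (Var x))) \<and>
       conv P E (Pi A B) t)"
| "generation P E (Pi A B) t \<longleftrightarrow>
     (\<exists>s1 s2 s3 L. typing P E A (Sort s1) \<and> finite L \<and>
       (\<forall>x. x \<notin> L \<longrightarrow> typing P (E @ [VarD x A]) (inst B (Var x)) (Sort s2)) \<and>
       conv P E (Sort s3) t)"

lemma generation_conv: "generation P E e t \<Longrightarrow> conv P E t t' \<Longrightarrow> generation P E e t'"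
  by (cases e) (simp; meson cv_trans)+

lemma typing_generation: "typing P E e t \<Longrightarrow> generation P E e t"
proof (induction rule: typing_induct)
  case name
  then show ?case by (auto intro: cv_refl)
next
  case sort
  then show ?case by (auto intro: cv_refl)
next
  case pi
  then show ?case by simp (blast intro: cv_refl)
next
  case lam
  then show ?case by simp (blast intro: cv_refl)
next
  case app
  then show ?case by simp (blast intro: cv_refl)
next
  case conv
  then show ?case by (blast intro: generation_conv)
qed

lemma Pi_domain_typed: "typing P E (Pi A B) t \<Longrightarrow> \<exists>s. typing P E A (Sort s)"
  by (auto dest: typing_generation)

section \<open>Correct environments\<close>

lemma typing_fv: "typing P E (e :: ('v::infinite, 's) pterm) t \<Longrightarrow> fv e \<subseteq> env_names E"
proof (induction rule: typing_induct)
  case (name E d x t)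
  then show ?case by (auto intro: declared_in_env_names)
next
  case (pi E A s1 L B s2 s3)
  then obtain x where "x \<notin> L \<union> fv B" by (metis ex_new_if_finite infinite_UNIV finite_UnI finite_fv)
  with pi.IH(2)[of x] pi.IH(1) show ?case using fv_open[of B 0 "Var x"] by auto
next
  case (lam E A B s L b)
  then obtain x where "x \<notin> L \<union> fv b" by (metis ex_new_if_finite infinite_UNIV finite_UnI finite_fv)
  with lam.IH(2)[of x] lam.IH(1) show ?case using fv_open[of b 0 "Var x"] by auto
qed auto

text \<open>A definition declares the same list of names as the plain variable declarations that its
  correctness rule starts from, so only \<open>ok_var\<close> adds a name.\<close>

lemma ok_distinct: "ok P E \<Longrightarrow> distinct (map fst (concat (map declared E)))"
proof (induction rule: ok_induct)
  case (var E t s x)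
  then show ?case by (auto simp: env_names_def)
qed (simp_all add: comp_def split_beta)

lemma ok_declared_fv:
  "ok P E \<Longrightarrow> d \<in> set E \<Longrightarrow> (x :: 'v::infinite, t) \<in> set (declared d) \<Longrightarrow> fv t \<subseteq> env_names E"
proof (induction arbitrary: d x t rule: ok_induct)
  case (var E u s y)
  from var.prems show ?case using var.IH typing_fv[OF var.hyps(1)] by fastforce
next
  case (ind E \<Gamma>I \<Gamma>C)
  show ?case
  proof (cases "d \<in> set E")
    case True
    with ind.IH[of d x t] ind.prems show ?thesis by auto
  next
    case False
    with ind.prems have "(x, t) \<in> set (\<Gamma>I @ \<Gamma>C)" by auto
    then show ?thesis using ind.IH[of "VarD x t" x t] by force
  qed
next
  case (rew E \<Gamma> R)
  show ?case
  proof (cases "d \<in> set E")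
    case True
    with rew.IH(1)[of d x t] rew.prems show ?thesis by auto
  next
    case False
    with rew.prems have "(x, t) \<in> set \<Gamma>" by auto
    then show ?thesis using rew.IH(1)[of "VarD x t" x t] by force
  qed
qed simp

lemma distinct_concat_same:
  assumes "distinct (map fst (concat (map f ds)))" "d \<in> set ds" "d' \<in> set ds"
    and "x \<in> fst ` set (f d)" "x \<in> fst ` set (f d')"
  shows "d = d'"
  using assms by (induction ds) force+

lemma ok_same_decl:
  assumes "ok P E" "d \<in> set E" "d' \<in> set E" "x \<in> names (declared d)" "x \<in> names (declared d')"
  shows "d = d'"
  using distinct_concat_same[OF ok_distinct[OF assms(1)] assms(2-5)] .

lemma ok_Ind:
  "ok P E \<Longrightarrow> Ind \<Gamma>I \<Gamma>C \<in> set E \<Longrightarrow>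
     (\<forall>(I, t)\<in>set \<Gamma>I. \<exists>s. target t = Sort s) \<and>
     (\<forall>(c, t)\<in>set \<Gamma>C. \<exists>I\<in>names \<Gamma>I. head (target t) = Var I)"
  by (induction rule: ok_induct) auto

text \<open>What the metatheory asks of a rule. Names outside \<open>\<Delta>\<close> are declared,
  so substituting for a fresh variable leaves them alone; the head symbol is no pattern variable, so
  each instance of the left-hand side keeps its head.\<close>

definition rule_wf :: "('v, 's) env \<Rightarrow> ('v, 's) ctx \<Rightarrow> ('v, 's) rule \<Rightarrow> bool" where
  "rule_wf E \<Gamma> = (\<lambda>(\<Delta>, l, r).
     fv l \<union> fv r \<union> (\<Union>(x, t)\<in>set \<Delta>. fv t) \<subseteq> env_names E \<union> names \<Delta> \<and>
     (\<exists>f\<in>names \<Gamma>. f \<notin> names \<Delta> \<and> head l = Var f))"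

lemma rule_wf_mono: "rule_wf E \<Gamma> \<rho> \<Longrightarrow> env_names E \<subseteq> env_names F \<Longrightarrow> rule_wf F \<Gamma> \<rho>"
  unfolding rule_wf_def by (cases \<rho>) (simp, blast)

text \<open>Correctness of \<open>E; \<Gamma>; \<Delta>\<close>, demanded for each rule, separates
  the defined symbols from the pattern variables and scopes the types of the latter.\<close>

lemma ok_Rew:
  "ok P E \<Longrightarrow> Rew \<Gamma> R \<in> set E \<Longrightarrow> \<rho> \<in> R \<Longrightarrow> rule_wf (E :: ('v::infinite, 's) env) \<Gamma> \<rho>"
proof (induction arbitrary: \<Gamma> R rule: ok_induct)
  case (var E t s x)
  then show ?case by (auto intro: rule_wf_mono[of E])
next
  case (ind E \<Gamma>I \<Gamma>C)
  then have "rule_wf (E @ vars \<Gamma>I @ vars \<Gamma>C) \<Gamma> \<rho>" by (intro ind.IH) auto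
  then show ?case by (rule rule_wf_mono) auto
next
  case (rew E \<Gamma>' R')
  show ?case
  proof (cases "Rew \<Gamma> R \<in> set E")
    case True
    then have "rule_wf (E @ vars \<Gamma>') \<Gamma> \<rho>" using rew.prems by (intro rew.IH(1)) auto
    then show ?thesis by (rule rule_wf_mono) auto
  next
    case False
    with rew.prems have [simp]: "\<Gamma>' = \<Gamma>" "R' = R" by auto
    obtain \<Delta> l r where \<rho>: "\<rho> = (\<Delta>, l, r)" by (cases \<rho>)
    with rew.prems have R: "(\<Delta>, l, r) \<in> R" by simp
    from rew.hyps(3) R have ok: "ok P (E @ vars \<Gamma> @ vars \<Delta>)" by simp
    have "names \<Gamma> \<inter> names \<Delta> = {}"
      using ok_distinct[OF ok] by (simp add: comp_def split_beta)
    have fv_t: "fv t \<subseteq> env_names E \<union> names \<Gamma> \<union> names \<Delta>" if "(x, t) \<in> set \<Delta>" for x t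
      using ok_declared_fv[OF ok, of "VarD x t" x t] that by force
    then have "(\<Union>(x, t)\<in>set \<Delta>. fv t) \<subseteq> env_names E \<union> names \<Gamma> \<union> names \<Delta>" by blast
    moreover note \<open>names \<Gamma> \<inter> names \<Delta> = {}\<close>
    moreover have "fv l \<union> fv r \<subseteq> env_names E \<union> names \<Gamma> \<union> names \<Delta>"
      "\<exists>f\<in>names \<Gamma>. head l = Var f"
      using bspec[OF rew.hyps(4), of "(\<Delta>, l, r)"] R by simp_all
    ultimately show ?thesis unfolding rule_wf_def \<rho> by (simp, blast)
  qed
qed simp

lemma well_typed_AppD: "well_typed P E (App a b) \<Longrightarrow> well_typed P E a \<and> well_typed P E b"
  unfolding well_typed_def using typing_generation by fastforce

lemma typing_PiD:
  assumes "typing P E (Pi A B) t"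
  obtains s1 s2 L where "typing P E A (Sort s1)" "finite L"
    "\<And>x. x \<notin> L \<Longrightarrow> typing P (E @ [VarD x A]) (inst B (Var x)) (Sort s2)"
  using typing_generation[OF assms] by auto

lemma typing_LamD:
  assumes "typing P E (Lam A b) t"
  obtains B s1 L where "typing P E A (Sort s1)" "finite L"
    "\<And>x. x \<notin> L \<Longrightarrow> typing P (E @ [VarD x A]) (inst b (Var x)) (inst B (Var x))"
  using typing_generation[OF assms] Pi_domain_typed by (metis generation.simps(5))

section \<open>Substitution and weakening\<close>

text \<open>Abstracts from the relation \<open>M\<close> so that one induction serves two instances:
  weakening, where \<open>\<sigma>\<close> is the identity, and proper substitution, whose
  \<open>extend\<close> condition already needs weakening. The condition \<open>rule\<close> keeps
  \<open>\<sigma>\<close> from altering the symbols of a rewrite rule, so that a substituted rewrite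
  step uses the same rule.\<close>

locale typed_substitutions =
  fixes P :: "('v::infinite, 's) gpts"
    and M :: "('v \<Rightarrow> ('v, 's) pterm) \<Rightarrow> ('v, 's) env \<Rightarrow> ('v, 's) env \<Rightarrow> bool"
  assumes lc: "M \<sigma> E E' \<Longrightarrow> lc_at 0 (\<sigma> x)"
    and ok: "M \<sigma> E E' \<Longrightarrow> ok P E'"
    and name: "M \<sigma> E E' \<Longrightarrow> d \<in> set E \<Longrightarrow> (x, t) \<in> set (declared d) \<Longrightarrow>
      typing P E' (\<sigma> x) (subst \<sigma> t)"
    and Rew: "M \<sigma> E E' \<Longrightarrow> Rew \<Gamma> R \<in> set E \<Longrightarrow> Rew \<Gamma> R \<in> set E'"
    and rule: "M \<sigma> E E' \<Longrightarrow> Rew \<Gamma> R \<in> set E \<Longrightarrow> (\<Delta>, l, r) \<in> R \<Longrightarrow>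
      x \<in> fv l \<union> fv r \<union> (\<Union>(y, t)\<in>set \<Delta>. fv t) - names \<Delta> \<Longrightarrow> \<sigma> x = Var x"
    and extend: "M \<sigma> E E' \<Longrightarrow> typing P E' (subst \<sigma> A) (Sort s) \<Longrightarrow>
      \<exists>L. finite L \<and> (\<forall>y. y \<notin> L \<longrightarrow>
        M (\<sigma>(y := Var y)) (E @ [VarD y A]) (E' @ [VarD y (subst \<sigma> A)]))"
begin

lemma inst_fresh:
  "M \<sigma> E E' \<Longrightarrow> y \<notin> fv t \<Longrightarrow>
     subst (\<sigma>(y := Var y)) (inst t (Var y)) = inst (subst \<sigma> t) (Var y)"
  using lc by (intro subst_inst_fresh)

lemma subst_inst: "M \<sigma> E E' \<Longrightarrow> subst \<sigma> (inst t u) = inst (subst \<sigma> t) (subst \<sigma> u)"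
  using lc by (intro subst_open_at)

text \<open>
  In the case of \<open>step\<close>, the substituted source has to be typed, for otherwise the domains of the binders
  that are crossed cannot be added to the environment.
\<close>

lemma
  shows "ok P E0 \<Longrightarrow> True"
    and typing_subst: "typing P E e t \<Longrightarrow> M \<sigma> E E' \<Longrightarrow> typing P E' (subst \<sigma> e) (subst \<sigma> t)"
    and step_subst: "step P F a b \<Longrightarrow> M \<sigma> F F' \<Longrightarrow> well_typed P F' (subst \<sigma> a) \<Longrightarrow>
      step P F' (subst \<sigma> a) (subst \<sigma> b)"
    and conv_subst: "conv P G u v \<Longrightarrow> M \<sigma> G G' \<Longrightarrow> conv P G' (subst \<sigma> u) (subst \<sigma> v)"
proof (induction E0 and E e t and F a b and G u v
    arbitrary: and \<sigma> E' and \<sigma> F' and \<sigma> G' rule: ok_typing_step_conv.inducts)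
  case (ty_name E d x t)
  then show ?case by (simp add: name)
next
  case (ty_sort E s1 s2)
  then show ?case by (simp add: ok_typing_step_conv.ty_sort ok)
next
  case (ty_pi E A s1 L B s2 s3)
  have A: "typing P E' (subst \<sigma> A) (Sort s1)" using ty_pi.IH(2) ty_pi.prems by simp
  from extend[OF ty_pi.prems A] obtain L' where L': "finite L'"
    "\<And>y. y \<notin> L' \<Longrightarrow> M (\<sigma>(y := Var y)) (E @ [VarD y A]) (E' @ [VarD y (subst \<sigma> A)])" by blast
  have "typing P (E' @ [VarD y (subst \<sigma> A)]) (inst (subst \<sigma> B) (Var y)) (Sort s2)"
    if "y \<notin> L \<union> L' \<union> fv B" for y
    using ty_pi.IH(4)[OF _ L'(2), of y] inst_fresh[OF ty_pi.prems, of y B] that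
    by (simp del: fun_upd_apply)
  then have "typing P E' (Pi (subst \<sigma> A) (subst \<sigma> B)) (Sort s3)"
    using A L'(1) ty_pi.hyps ty_pi.IH(5)
    by (intro ok_typing_step_conv.ty_pi[of _ _ _ s1 "L \<union> L' \<union> fv B" _ s2]) auto
  then show ?case by simp
next
  case (ty_lam E A B s L b)
  have AB: "typing P E' (Pi (subst \<sigma> A) (subst \<sigma> B)) (Sort s)"
    using ty_lam.IH(2) ty_lam.prems by simp
  then obtain s1 where "typing P E' (subst \<sigma> A) (Sort s1)" using Pi_domain_typed by blast
  from extend[OF ty_lam.prems this] obtain L' where L': "finite L'"
    "\<And>y. y \<notin> L' \<Longrightarrow> M (\<sigma>(y := Var y)) (E @ [VarD y A]) (E' @ [VarD y (subst \<sigma> A)])" by blast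
  have "typing P (E' @ [VarD y (subst \<sigma> A)]) (inst (subst \<sigma> b) (Var y)) (inst (subst \<sigma> B) (Var y))"
    if "y \<notin> L \<union> L' \<union> fv B \<union> fv b" for y
    using ty_lam.IH(4)[OF _ L'(2), of y] inst_fresh[OF ty_lam.prems, of y b]
      inst_fresh[OF ty_lam.prems, of y B] that by (simp del: fun_upd_apply)
  then have "typing P E' (Lam (subst \<sigma> A) (subst \<sigma> b)) (Pi (subst \<sigma> A) (subst \<sigma> B))"
    using AB L'(1) ty_lam.hyps
    by (intro ok_typing_step_conv.ty_lam[of _ _ _ _ s "L \<union> L' \<union> fv B \<union> fv b"]) auto
  then show ?case by simp
next
  case (ty_app E a A B b)
  then show ?case using ok_typing_step_conv.ty_app subst_inst by fastforce
next
  case (ty_conv E e t t' s)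
  then show ?case using ok_typing_step_conv.ty_conv by fastforce
next
  case (st_beta E A b a)
  then show ?case using ok_typing_step_conv.st_beta by (fastforce simp: subst_inst)
next
  case (st_rew \<Gamma> R E \<Delta> l r \<delta>)
  \<comment> \<open>The composition of \<open>\<sigma>\<close> after \<open>\<delta>\<close>, cut
    off outside \<open>\<Delta>\<close> because \<open>st_rew\<close> wants the identity there. On
    the names of the rule the cut makes no difference, by the locale assumption
    \<open>rule\<close>.\<close>
  define \<delta>' where "\<delta>' x = (if x \<in> names \<Delta> then subst \<sigma> (\<delta> x) else Var x)" for x
  have eq: "subst \<sigma> (subst \<delta> t) = subst \<delta>' t"
    if "fv t \<subseteq> fv l \<union> fv r \<union> (\<Union>(y, t)\<in>set \<Delta>. fv t)" for t
    unfolding subst_subst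
  proof (rule subst_cong)
    fix x assume "x \<in> fv t"
    with that have "x \<in> fv l \<union> fv r \<union> (\<Union>(y, t)\<in>set \<Delta>. fv t)" by blast
    then show "subst \<sigma> (\<delta> x) = \<delta>' x"
      using st_rew.hyps(3) rule[OF st_rew.prems(1) st_rew.hyps(1,2), of x]
      by (cases "x \<in> names \<Delta>") (auto simp: \<delta>'_def)
  qed
  have "step P F' (subst \<delta>' l) (subst \<delta>' r)"
  proof (rule ok_typing_step_conv.st_rew[OF Rew[OF st_rew.prems(1) st_rew.hyps(1)] st_rew.hyps(2)])
    fix x t assume xt: "(x, t) \<in> set \<Delta>"
    then have "x \<in> names \<Delta>" by force
    moreover have "fv t \<subseteq> fv l \<union> fv r \<union> (\<Union>(y, t)\<in>set \<Delta>. fv t)" using xt by blast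
    ultimately show "typing P F' (\<delta>' x) (subst \<delta>' t)"
      using st_rew.IH(2)[OF xt st_rew.prems(1)] eq[of t] by (simp add: \<delta>'_def)
  qed (simp add: \<delta>'_def)
  then show ?case using eq[of l] eq[of r] by (metis (no_types, lifting) Un_upper1 Un_upper2 le_supI1)
next
  case (st_app1 E a a' b)
  from st_app1.prems(2) have "well_typed P F' (subst \<sigma> a)"
    by (auto dest: well_typed_AppD)
  with st_app1 show ?case by (simp add: ok_typing_step_conv.st_app1)
next
  case (st_app2 E b b' a)
  from st_app2.prems(2) have "well_typed P F' (subst \<sigma> b)"
    by (auto dest: well_typed_AppD)
  with st_app2 show ?case by (simp add: ok_typing_step_conv.st_app2)
next
  case (st_lam1 E A A' b)
  from st_lam1.prems(2) have "well_typed P F' (subst \<sigma> A)"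
    by (auto simp: well_typed_def elim: typing_LamD)
  with st_lam1 show ?case by (simp add: ok_typing_step_conv.st_lam1)
next
  case (st_lam2 L E A b b')
  from st_lam2.prems(2) obtain u where "typing P F' (subst \<sigma> (Lam A b)) u" by (auto simp: well_typed_def)
  then have "typing P F' (Lam (subst \<sigma> A) (subst \<sigma> b)) u" by simp
  then obtain B s1 L1 where A: "typing P F' (subst \<sigma> A) (Sort s1)" and "finite L1"
    and b: "\<And>x. x \<notin> L1 \<Longrightarrow>
      typing P (F' @ [VarD x (subst \<sigma> A)]) (inst (subst \<sigma> b) (Var x)) (inst B (Var x))"
    by (rule typing_LamD) blast
  from extend[OF st_lam2.prems(1) A] obtain L' where L': "finite L'"
    "\<And>y. y \<notin> L' \<Longrightarrow> M (\<sigma>(y := Var y)) (E @ [VarD y A]) (F' @ [VarD y (subst \<sigma> A)])" by blast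
  have "step P (F' @ [VarD y (subst \<sigma> A)]) (inst (subst \<sigma> b) (Var y)) (inst (subst \<sigma> b') (Var y))"
    if "y \<notin> L \<union> L' \<union> L1 \<union> fv b \<union> fv b'" for y
    using st_lam2.IH(2)[OF _ L'(2), of y] b[of y] inst_fresh[OF st_lam2.prems(1), of y b]
      inst_fresh[OF st_lam2.prems(1), of y b'] that
    by (auto simp: well_typed_def simp del: fun_upd_apply)
  then have "step P F' (Lam (subst \<sigma> A) (subst \<sigma> b)) (Lam (subst \<sigma> A) (subst \<sigma> b'))"
    using L'(1) \<open>finite L1\<close> st_lam2.hyps
    by (intro ok_typing_step_conv.st_lam2[of "L \<union> L' \<union> L1 \<union> fv b \<union> fv b'"]) auto
  then show ?case by simp
next
  case (st_pi1 E A A' B)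
  from st_pi1.prems(2) have "well_typed P F' (subst \<sigma> A)"
    by (auto simp: well_typed_def elim: typing_PiD)
  with st_pi1 show ?case by (simp add: ok_typing_step_conv.st_pi1)
next
  case (st_pi2 L E A b b')
  from st_pi2.prems(2) obtain u where "typing P F' (subst \<sigma> (Pi A b)) u" by (auto simp: well_typed_def)
  then have "typing P F' (Pi (subst \<sigma> A) (subst \<sigma> b)) u" by simp
  then obtain s s1 L1 where A: "typing P F' (subst \<sigma> A) (Sort s1)" and "finite L1"
    and b: "\<And>x. x \<notin> L1 \<Longrightarrow>
      typing P (F' @ [VarD x (subst \<sigma> A)]) (inst (subst \<sigma> b) (Var x)) (Sort s)"
    by (rule typing_PiD) blast
  from extend[OF st_pi2.prems(1) A] obtain L' where L': "finite L'"
    "\<And>y. y \<notin> L' \<Longrightarrow> M (\<sigma>(y := Var y)) (E @ [VarD y A]) (F' @ [VarD y (subst \<sigma> A)])" by blast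
  have "step P (F' @ [VarD y (subst \<sigma> A)]) (inst (subst \<sigma> b) (Var y)) (inst (subst \<sigma> b') (Var y))"
    if "y \<notin> L \<union> L' \<union> L1 \<union> fv b \<union> fv b'" for y
    using st_pi2.IH(2)[OF _ L'(2), of y] b[of y] inst_fresh[OF st_pi2.prems(1), of y b]
      inst_fresh[OF st_pi2.prems(1), of y b'] that
    by (auto simp: well_typed_def simp del: fun_upd_apply)
  then have "step P F' (Pi (subst \<sigma> A) (subst \<sigma> b)) (Pi (subst \<sigma> A) (subst \<sigma> b'))"
    using L'(1) \<open>finite L1\<close> st_pi2.hyps
    by (intro ok_typing_step_conv.st_pi2[of "L \<union> L' \<union> L1 \<union> fv b \<union> fv b'"]) auto
  then show ?case by simp
next
  case (cv_refl E a)
  show ?case by (rule ok_typing_step_conv.cv_refl)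
next
  case (cv_step E a b t t')
  \<comment> \<open>Conversion steps join typed terms, so the induction hypothesis for the source
    meets the typedness demanded by the step case.\<close>
  then have "typing P G' (subst \<sigma> a) (subst \<sigma> t)" "typing P G' (subst \<sigma> b) (subst \<sigma> t')" by auto
  moreover from this have "step P G' (subst \<sigma> a) (subst \<sigma> b)"
    using cv_step.IH cv_step.prems unfolding well_typed_def by blast
  ultimately show ?case by (intro ok_typing_step_conv.cv_step)
next
  case (cv_sym E a b)
  then show ?case by (blast intro: ok_typing_step_conv.cv_sym)
next
  case (cv_trans E a b c)
  then show ?case by (blast intro: ok_typing_step_conv.cv_trans)
qed auto

end

text \<open>Compares declared pairs rather than declarations. Thus replacing plain variable
  declarations by the inductive or rewrite definition that declares the same names counts as
  weakening.\<close>

definition weakens :: "('v, 's) gpts \<Rightarrow> ('v, 's) env \<Rightarrow> ('v, 's) env \<Rightarrow> bool" where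
  "weakens P E E' \<longleftrightarrow> ok P E' \<and>
     set (concat (map declared E)) \<subseteq> set (concat (map declared E')) \<and>
     (\<forall>\<Gamma> R. Rew \<Gamma> R \<in> set E \<longrightarrow> Rew \<Gamma> R \<in> set E')"

lemma typing_weaken:
  fixes P :: "('v::infinite, 's) gpts"
  assumes "typing P E e t" "weakens P E E'"
  shows "typing P E' e t"
proof -
  interpret typed_substitutions P "\<lambda>\<sigma> E E'. \<sigma> = Var \<and> weakens P E E'"
  proof
    fix \<sigma> :: "'v \<Rightarrow> ('v, 's) pterm" and E E' d x t
    assume "\<sigma> = Var \<and> weakens P E E'" "d \<in> set E" "(x, t) \<in> set (declared d)"
    then have "\<exists>d\<in>set E'. (x, t) \<in> set (declared d)" and "ok P E'" "\<sigma> = Var"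
      by (auto simp: weakens_def)
    then show "typing P E' (\<sigma> x) (subst \<sigma> t)" by (auto intro: ty_name)
  next
    fix \<sigma> :: "'v \<Rightarrow> ('v, 's) pterm" and E E' A s
    assume "\<sigma> = Var \<and> weakens P E E'" "typing P E' (subst \<sigma> A) (Sort s)"
    then show "\<exists>L. finite L \<and> (\<forall>y. y \<notin> L \<longrightarrow> \<sigma>(y := Var y) = Var \<and>
        weakens P (E @ [VarD y A]) (E' @ [VarD y (subst \<sigma> A)]))"
      by (intro exI[of _ "env_names E'"]) (auto simp: weakens_def intro: ok_var)
  qed (auto simp: weakens_def)
  from typing_subst[OF assms(1), of Var E'] assms(2) show ?thesis by simp
qed

lemma weakens_append: "ok P (E @ F) \<Longrightarrow> weakens P E (E @ F)"
  by (auto simp: weakens_def)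

text \<open>The types in a definition are typed while its names are still plain variables;
  \<open>weakens\<close> transports this to the environment with the definition itself.\<close>

lemma ok_declared_typed:
  fixes P :: "('v::infinite, 's) gpts"
  shows "ok P E \<Longrightarrow> d \<in> set E \<Longrightarrow> (x, t) \<in> set (declared d) \<Longrightarrow> \<exists>s. typing P E t (Sort s)"
proof (induction arbitrary: d x t rule: ok_induct)
  case (var E u s y)
  then have "weakens P E (E @ [VarD y u])" by (intro weakens_append ok_var)
  moreover have "\<exists>s. typing P E t (Sort s)" using var by auto
  ultimately show ?case by (blast intro: typing_weaken)
next
  case (ind E \<Gamma>I \<Gamma>C)
  let ?F = "E @ vars \<Gamma>I @ vars \<Gamma>C"
  from ind.hyps have "ok P (E @ [Ind \<Gamma>I \<Gamma>C])" by (intro ok_ind)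
  then have "weakens P ?F (E @ [Ind \<Gamma>I \<Gamma>C])"
    by (auto simp: weakens_def)
  moreover have "\<exists>d\<in>set ?F. (x, t) \<in> set (declared d)"
    using ind.prems by force
  ultimately show ?case using ind.IH by (blast intro: typing_weaken)
next
  case (rew E \<Gamma> R)
  let ?F = "E @ vars \<Gamma>"
  from rew.hyps have "ok P (E @ [Rew \<Gamma> R])" by (intro ok_rew)
  then have "weakens P ?F (E @ [Rew \<Gamma> R])"
    by (auto simp: weakens_def)
  moreover have "\<exists>d\<in>set ?F. (x, t) \<in> set (declared d)"
    using rew.prems by force
  ultimately show ?case using rew.IH(1) by (blast intro: typing_weaken)
qed simp

section \<open>Substitution of typed terms\<close>

definition env_subst ::
  "('v, 's) gpts \<Rightarrow> ('v \<Rightarrow> ('v, 's) pterm) \<Rightarrow> ('v, 's) env \<Rightarrow> ('v, 's) env \<Rightarrow> bool" where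
  "env_subst P \<sigma> E E' \<longleftrightarrow> (\<forall>x. lc_at 0 (\<sigma> x)) \<and> ok P E' \<and>
     (\<forall>d x t. d \<in> set E \<longrightarrow> (x, t) \<in> set (declared d) \<longrightarrow> typing P E' (\<sigma> x) (subst \<sigma> t)) \<and>
     (\<forall>\<Gamma> R. Rew \<Gamma> R \<in> set E \<longrightarrow> Rew \<Gamma> R \<in> set E') \<and>
     (\<forall>\<Gamma> R \<Delta> l r x. Rew \<Gamma> R \<in> set E \<longrightarrow> (\<Delta>, l, r) \<in> R \<longrightarrow>
       x \<in> fv l \<union> fv r \<union> (\<Union>(y, t)\<in>set \<Delta>. fv t) - names \<Delta> \<longrightarrow> \<sigma> x = Var x)"

lemma env_substI:
  assumes "\<And>x. lc_at 0 (\<sigma> x)" "ok P E'"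
    and "\<And>d x t. d \<in> set E \<Longrightarrow> (x, t) \<in> set (declared d) \<Longrightarrow> typing P E' (\<sigma> x) (subst \<sigma> t)"
    and "\<And>\<Gamma> R. Rew \<Gamma> R \<in> set E \<Longrightarrow> Rew \<Gamma> R \<in> set E'"
    and "\<And>\<Gamma> R \<Delta> l r x. Rew \<Gamma> R \<in> set E \<Longrightarrow> (\<Delta>, l, r) \<in> R \<Longrightarrow>
       x \<in> fv l \<union> fv r \<union> (\<Union>(y, t)\<in>set \<Delta>. fv t) - names \<Delta> \<Longrightarrow> \<sigma> x = Var x"
  shows "env_subst P \<sigma> E E'"
  unfolding env_subst_def using assms by simp

text \<open>As \<open>y\<close> occurs in no declaration, overriding \<open>\<sigma>\<close> at
  \<open>y\<close> changes neither the images of the old names nor their substituted types, and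
  weakening moves these typings under the new declaration.\<close>

lemma env_subst_extend:
  fixes P :: "('v::infinite, 's) gpts"
  assumes "env_subst P \<sigma> E E'" "typing P E' (subst \<sigma> A) (Sort s)"
    and y: "y \<notin> env_names E \<union> env_names E' \<union> fv A \<union> (\<Union>d\<in>set E. \<Union>(x, t)\<in>set (declared d). fv t)"
  shows "env_subst P (\<sigma>(y := Var y)) (E @ [VarD y A]) (E' @ [VarD y (subst \<sigma> A)])"
proof -
  let ?\<sigma> = "\<sigma>(y := Var y)" and ?E' = "E' @ [VarD y (subst \<sigma> A)]"
  have ok: "ok P ?E'" using assms by (intro ok_var) auto
  show ?thesis
  proof (rule env_substI)
    show "lc_at 0 (?\<sigma> x)" for x using assms(1) by (simp add: env_subst_def)
    show "ok P ?E'" by (rule ok)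
  next
    fix d x t assume d: "d \<in> set (E @ [VarD y A])" "(x, t) \<in> set (declared d)"
    show "typing P ?E' (?\<sigma> x) (subst ?\<sigma> t)"
    proof (cases "d \<in> set E")
      case True
      then have "y \<notin> fv t" "x \<noteq> y" using y d(2) by (auto dest: declared_in_env_names)
      then have "subst ?\<sigma> t = subst \<sigma> t" "?\<sigma> x = \<sigma> x" by (auto intro: subst_cong)
      moreover have "typing P E' (\<sigma> x) (subst \<sigma> t)"
        using assms(1) True d(2) by (simp add: env_subst_def)
      ultimately show ?thesis using typing_weaken weakens_append[OF ok] by metis
    next
      case False
      with d have "x = y" "t = A" by auto
      moreover have "subst ?\<sigma> A = subst \<sigma> A" using y by (intro subst_cong) auto
      ultimately show ?thesis using ty_name[OF ok, of "VarD y (subst \<sigma> A)" y] by simp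
    qed
  next
    fix \<Gamma> R assume R: "Rew \<Gamma> R \<in> set (E @ [VarD y A])"
    then show "Rew \<Gamma> R \<in> set ?E'" using assms(1) by (simp add: env_subst_def)
    fix \<Delta> l r x
    assume "(\<Delta>, l, r) \<in> R" "x \<in> fv l \<union> fv r \<union> (\<Union>(y, t)\<in>set \<Delta>. fv t) - names \<Delta>"
    moreover have "Rew \<Gamma> R \<in> set E" using R by simp
    ultimately have "\<sigma> x = Var x" using assms(1) unfolding env_subst_def by blast
    then show "?\<sigma> x = Var x" by simp
  qed
qed

lemma typed_substitutions_env_subst:
  "typed_substitutions P (env_subst P)" for P :: "('v::infinite, 's) gpts"
proof
  fix \<sigma> :: "'v \<Rightarrow> ('v, 's) pterm" and E E' :: "('v, 's) env" and A :: "('v, 's) pterm" and s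
  let ?L = "env_names E \<union> env_names E' \<union> fv A \<union> (\<Union>d\<in>set E. \<Union>(x, t)\<in>set (declared d). fv t)"
  assume "env_subst P \<sigma> E E'" "typing P E' (subst \<sigma> A) (Sort s)"
  then show "\<exists>L. finite L \<and> (\<forall>y. y \<notin> L \<longrightarrow>
      env_subst P (\<sigma>(y := Var y)) (E @ [VarD y A]) (E' @ [VarD y (subst \<sigma> A)]))"
    by (intro exI[of _ ?L] conjI allI impI, force) (rule env_subst_extend)
qed (simp_all add: env_subst_def)

text \<open>The variable \<open>x\<close> is declared last and is new, so neither the types nor the
  rules of \<open>E\<close> mention it, and replacing it gives a typed substitution into
  \<open>E\<close> itself.\<close>

lemma typing_subst1:
  fixes P :: "('v::infinite, 's) gpts"
  assumes e: "typing P (E @ [VarD x A]) e t" and b: "typing P E b A"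
    and x: "x \<notin> env_names E" and A: "typing P E A (Sort s)"
  shows "typing P E (subst (Var(x := b)) e) (subst (Var(x := b)) t)"
proof -
  let ?\<sigma> = "Var(x := b)"
  have ok: "ok P E" using b by (rule typing_ok)
  have id: "subst ?\<sigma> u = u" if "fv u \<subseteq> env_names E" for u
    using that x by (intro subst_id) auto
  have "env_subst P ?\<sigma> (E @ [VarD x A]) E"
  proof (rule env_substI)
    show "lc_at 0 (?\<sigma> y)" for y using typing_lc[OF b] by simp
    show "ok P E" by (rule ok)
  next
    fix d y u assume d: "d \<in> set (E @ [VarD x A])" "(y, u) \<in> set (declared d)"
    show "typing P E (?\<sigma> y) (subst ?\<sigma> u)"
    proof (cases "d \<in> set E")
      case True
      then have "y \<noteq> x" using declared_in_env_names d(2) x by metis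
      with id[OF ok_declared_fv[OF ok True d(2)]] show ?thesis
        using ok True d(2) by (auto intro: ty_name)
    next
      case False
      with d have "y = x" "u = A" by auto
      with b id[OF typing_fv[OF A]] show ?thesis by simp
    qed
  next
    fix \<Gamma> R assume R: "Rew \<Gamma> R \<in> set (E @ [VarD x A])"
    then show R': "Rew \<Gamma> R \<in> set E" by simp
    fix \<Delta> l r y
    assume "(\<Delta>, l, r) \<in> R" and y: "y \<in> fv l \<union> fv r \<union> (\<Union>(y, t)\<in>set \<Delta>. fv t) - names \<Delta>"
    then have "rule_wf E \<Gamma> (\<Delta>, l, r)" using ok_Rew[OF ok R'] by blast
    then have "y \<in> env_names E" using y unfolding rule_wf_def by blast
    then show "?\<sigma> y = Var y" using x by auto
  qed
  then show ?thesis using typed_substitutions.typing_subst[OF typed_substitutions_env_subst e] by blast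
qed

section \<open>Types are sorts or typed by sorts\<close>

text \<open>Open the codomain with a name fresh for \<open>B\<close>, then substitute
  \<open>b\<close> for that name.\<close>

lemma typing_inst:
  fixes P :: "('v::infinite, 's) gpts"
  assumes "typing P E (Pi A B) t" "typing P E b A"
  shows "\<exists>s. typing P E (inst B b) (Sort s)"
proof -
  from assms(1) obtain s1 s2 L where A: "typing P E A (Sort s1)" and "finite L"
    and B: "\<And>x. x \<notin> L \<Longrightarrow> typing P (E @ [VarD x A]) (inst B (Var x)) (Sort s2)"
    by (rule typing_PiD) blast
  then obtain x where x: "x \<notin> L \<union> env_names E \<union> fv B"
    by (metis ex_new_if_finite infinite_UNIV finite_UnI finite_fv finite_env_names)
  let ?\<sigma> = "Var(x := b)"
  have "typing P E (subst ?\<sigma> (inst B (Var x))) (Sort s2)"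
    using typing_subst1[OF B assms(2) _ A, of x] x by simp
  moreover have "subst ?\<sigma> (inst B (Var x)) = inst (subst ?\<sigma> B) b"
    using typing_lc[OF assms(2)] by (subst subst_open_at) auto
  moreover have "subst ?\<sigma> B = B" using x by (intro subst_id) auto
  ultimately show ?thesis by auto
qed

lemma type_correctness:
  fixes P :: "('v::infinite, 's) gpts"
  shows "typing P E e t \<Longrightarrow> (\<exists>s. t = Sort s) \<or> (\<exists>s. typing P E t (Sort s))"
proof (induction rule: typing_induct)
  case name
  then show ?case using ok_declared_typed by blast
next
  case app
  then show ?case using typing_inst by blast
qed auto

section \<open>Reduction and heads\<close>

definition rew_names :: "('v, 's) env \<Rightarrow> 'v set" where
  "rew_names E = {f. \<exists>\<Gamma> R. Rew \<Gamma> R \<in> set E \<and> f \<in> names \<Gamma>}"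

lemma Ind_not_rew_name:
  assumes "ok P E" "Ind \<Gamma>I \<Gamma>C \<in> set E" "x \<in> names (\<Gamma>I @ \<Gamma>C)"
  shows "x \<notin> rew_names E"
proof
  assume "x \<in> rew_names E"
  then obtain \<Gamma> R where "Rew \<Gamma> R \<in> set E" "x \<in> names \<Gamma>" unfolding rew_names_def by blast
  with ok_same_decl[OF assms(1,2), of "Rew \<Gamma> R" x] assms(3) show False by auto
qed

lemma rew_step_head:
  fixes P :: "('v::infinite, 's) gpts"
  assumes "ok P E" "Rew \<Gamma> R \<in> set E" "(\<Delta>, l, r) \<in> R" "\<forall>x. x \<notin> names \<Delta> \<longrightarrow> \<delta> x = Var x"
  shows "\<exists>f\<in>rew_names E. head (subst \<delta> l) = Var f"
proof -
  have "rule_wf E \<Gamma> (\<Delta>, l, r)" using ok_Rew[OF assms(1-3)] .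
  then obtain f where f: "f \<in> names \<Gamma>" "f \<notin> names \<Delta>" "head l = Var f"
    unfolding rule_wf_def by blast
  with assms(4) have "head (subst \<delta> l) = Var f" by (simp add: head_subst)
  moreover have "f \<in> rew_names E" using f(1) assms(2) unfolding rew_names_def by blast
  ultimately show ?thesis by blast
qed

text \<open>A head that reduction cannot touch: it starts no \<open>\<beta>\<close>-redex, and by
  \<open>rew_step_head\<close> no instance of a left-hand side. Sorts and applied inductive types
  are the cases of interest.\<close>

definition rigid :: "('v, 's) env \<Rightarrow> ('v, 's) pterm \<Rightarrow> bool" where
  "rigid E t \<longleftrightarrow> (\<exists>s. head t = Sort s) \<or> (\<exists>x. x \<notin> rew_names E \<and> head t = Var x)"

lemma step_rigid:
  fixes P :: "('v::infinite, 's) gpts"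
  assumes "step P E a b" "ok P E" "rigid E a"
  shows "head b = head a"
  using assms
proof (induction rule: step_induct)
  case (rew \<Gamma> R E \<Delta> l r \<delta>)
  then obtain f where "f \<in> rew_names E" "head (subst \<delta> l) = Var f"
    using rew_step_head[OF rew.prems(1) rew.hyps(1,2,4)] by blast
  with rew.prems(2) show ?case by (auto simp: rigid_def)
qed (auto simp: rigid_def)

lemma steps_rigid:
  fixes P :: "('v::infinite, 's) gpts"
  assumes "(step P E)\<^sup>*\<^sup>* a b" "ok P E" "rigid E a"
  shows "head b = head a"
  using assms(1)
proof (induction rule: rtranclp_induct)
  case (step b c)
  then have "rigid E b" using assms(3) by (simp add: rigid_def)
  with step assms(2) step_rigid show ?case by metis
qed simp

text \<open>A rewrite redex is headed by a function symbol, so a product reduces only inside. The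
  domain is traced because arguments are later retyped along it.\<close>

lemma step_Pi:
  fixes P :: "('v::infinite, 's) gpts"
  assumes "step P E (Pi A B) c" "ok P E"
  shows "\<exists>A' B'. c = Pi A' B' \<and> (step P E A A' \<or> A' = A)"
  using assms
proof (cases rule: step.cases)
  case (st_rew \<Gamma> R \<Delta> l r \<delta>)
  then have "\<exists>f\<in>rew_names E. head (subst \<delta> l) = Var f"
    using rew_step_head[OF assms(2) st_rew(3,4), of \<delta>] by blast
  with st_rew(1) show ?thesis by (metis head.simps(6) pterm.distinct(9))
qed auto

lemma steps_Pi:
  fixes P :: "('v::infinite, 's) gpts"
  assumes "(step P E)\<^sup>*\<^sup>* (Pi A B) c" "ok P E"
  shows "\<exists>A' B'. c = Pi A' B' \<and> (step P E)\<^sup>*\<^sup>* A A'"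
  using assms(1)
proof (induction rule: rtranclp_induct)
  case (step b c)
  then obtain A' B' where b: "b = Pi A' B'" "(step P E)\<^sup>*\<^sup>* A A'" by blast
  with step_Pi[OF _ assms(2)] step(2) obtain A'' B'' where
    "c = Pi A'' B''" "step P E A' A'' \<or> A'' = A'" by blast
  with b show ?case by (auto intro: rtranclp.rtrancl_into_rtrancl)
qed simp

lemma well_typed_apps: "well_typed P E (apps a es) \<Longrightarrow> well_typed P E a"
  by (induction es arbitrary: a) (auto dest: well_typed_AppD)

lemma well_typed_apps_arg:
  assumes "well_typed P E (apps a es)" "d \<in> set es"
  shows "well_typed P E d"
proof -
  from assms(2) obtain bs cs where "es = bs @ d # cs" by (blast dest: split_list)
  with assms(1) have "well_typed P E (App (apps a bs) d)" using well_typed_apps by simp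
  then show ?thesis using well_typed_AppD by blast
qed

section \<open>Consequences of the standing assumptions (P1)-(P4)\<close>

locale standing =
  fixes P :: "('v::infinite, 's) gpts"
  assumes P1: "subject_reduction P"
    and P2: "uniqueness_of_types P"
    and P3: "strong_normalization P"
    and P4: "confluence P"
begin

lemma steps_typing:
  assumes "(step P E)\<^sup>*\<^sup>* a b" "typing P E a t"
  shows "typing P E b t"
  using assms by (induction rule: rtranclp_induct) (use P1 in \<open>auto simp: subject_reduction_def\<close>)

lemma steps_conv:
  assumes "(step P E)\<^sup>*\<^sup>* a b" "typing P E a t"
  shows "conv P E a b"
  using assms(1)
proof (induction rule: rtranclp_induct)
  case base
  show ?case by (rule cv_refl)
next
  case (step b c)
  have b: "typing P E b t" using steps_typing step(1) assms(2) by blast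
  then have "typing P E c t" using P1 step(2) unfolding subject_reduction_def by blast
  then have "conv P E b c" using cv_step step(2) b by blast
  with step.IH show ?case by (blast intro: cv_trans)
qed

text \<open>Conversion is reflexive on untyped terms as well, hence the first alternative. Otherwise
  all terms of the chain are typed, and transitivity is confluence at the middle term.\<close>

lemma conv_joinable:
  assumes "conv P E a b"
  shows "a = b \<or> (well_typed P E a \<and> well_typed P E b \<and>
    (\<exists>d. (step P E)\<^sup>*\<^sup>* a d \<and> (step P E)\<^sup>*\<^sup>* b d))"
  using assms
proof (induction rule: conv_induct)
  case (step E a b t t')
  then show ?case unfolding well_typed_def by blast
next
  case (trans E a b c)
  show ?case
  proof (cases "a = b \<or> b = c")
    case True
    with trans.IH show ?thesis by blast
  next
    case False
    with trans.IH obtain d e where d: "(step P E)\<^sup>*\<^sup>* a d" "(step P E)\<^sup>*\<^sup>* b d"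
      and e: "(step P E)\<^sup>*\<^sup>* b e" "(step P E)\<^sup>*\<^sup>* c e"
      and wt: "well_typed P E a" "well_typed P E b" "well_typed P E c" by blast
    from P4 wt(2) d(2) e(1) obtain f where "(step P E)\<^sup>*\<^sup>* d f" "(step P E)\<^sup>*\<^sup>* e f"
      unfolding confluence_def by blast
    with d e wt show ?thesis by (meson rtranclp_trans)
  qed
qed blast+

lemma conv_rigid:
  assumes "conv P E a b" "ok P E" "rigid E a" "rigid E b"
  shows "head a = head b"
  using conv_joinable[OF assms(1)] steps_rigid assms(2-4) by metis

lemma conv_Pi_not_rigid:
  assumes "conv P E (Pi A B) t" "ok P E"
  shows "\<not> rigid E t"
proof
  assume t: "rigid E t"
  have "t \<noteq> Pi A B" using t by (auto simp: rigid_def)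
  then obtain d where "(step P E)\<^sup>*\<^sup>* (Pi A B) d" "(step P E)\<^sup>*\<^sup>* t d"
    using conv_joinable[OF assms(1)] by blast
  with steps_Pi steps_rigid assms(2) t obtain A' B' where "Pi A' B' = d" "head d = head t" by metis
  with t show False by (auto simp: rigid_def)
qed

text \<open>Generation gives \<open>a\<close> some product type, perhaps not the given one. By
  uniqueness the two products are convertible; if they differ, a common reduct makes their domains
  convertible, and \<open>b\<close> can be retyped.\<close>

lemma typing_App:
  assumes "typing P E a (Pi A B)" "well_typed P E (App a b)"
  shows "typing P E b A \<and> typing P E (App a b) (inst B b)"
proof -
  from assms(2) obtain t where "generation P E (App a b) t"
    unfolding well_typed_def using typing_generation by blast
  then obtain A' B' where a: "typing P E a (Pi A' B')" and b: "typing P E b A'" by auto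
  have ok: "ok P E" using b by (rule typing_ok)
  have conv: "conv P E (Pi A' B') (Pi A B)"
    using P2 a assms(1) unfolding uniqueness_of_types_def by blast
  have "typing P E b A"
  proof (cases "Pi A' B' = Pi A B")
    case True
    with b show ?thesis by simp
  next
    case False
    with conv_joinable[OF conv] obtain d where wt: "well_typed P E (Pi A' B')" "well_typed P E (Pi A B)"
      and d: "(step P E)\<^sup>*\<^sup>* (Pi A' B') d" "(step P E)\<^sup>*\<^sup>* (Pi A B) d" by blast
    from steps_Pi[OF d(1) ok] obtain D F where D: "d = Pi D F" "(step P E)\<^sup>*\<^sup>* A' D" by blast
    with steps_Pi[OF d(2) ok] have AD: "(step P E)\<^sup>*\<^sup>* A D" by blast
    from wt obtain s s' where A: "typing P E A (Sort s)" "typing P E A' (Sort s')"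
      using Pi_domain_typed unfolding well_typed_def by meson
    have "conv P E A' A"
      using steps_conv[OF AD A(1)] steps_conv[OF D(2) A(2)] by (blast intro: cv_trans cv_sym)
    with b A(1) show ?thesis by (rule ty_conv)
  qed
  with assms(1) show ?thesis by (blast intro: ty_app)
qed

lemma App_not_rigid:
  assumes "typing P E a t" "rigid E t"
  shows "\<not> well_typed P E (App a b)"
proof
  assume "well_typed P E (App a b)"
  then obtain u where "generation P E (App a b) u"
    unfolding well_typed_def using typing_generation by blast
  then obtain A B where "typing P E a (Pi A B)" by auto
  then have "conv P E (Pi A B) t" "ok P E"
    using P2 assms(1) typing_ok unfolding uniqueness_of_types_def by blast+
  with conv_Pi_not_rigid assms(2) show False by blast
qed

text \<open>\<open>nf\<close> is a definite description: strong normalization gives existence,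
  confluence uniqueness.\<close>

lemma typed_nf:
  assumes "typing P E e t"
  shows "(step P E)\<^sup>*\<^sup>* e (nf P E e) \<and> normal P E (nf P E e)"
proof -
  have wt: "well_typed P E e" using assms unfolding well_typed_def by blast
  then have "termip (step P E) e"
    using P3 typing_ok[OF assms] unfolding strong_normalization_def by blast
  then have "\<exists>u. (step P E)\<^sup>*\<^sup>* e u \<and> normal P E u"
  proof (induction rule: accp_induct_rule)
    case (1 x)
    then show ?case
      by (cases "normal P E x")
        (auto simp: normal_def intro: converse_rtranclp_into_rtranclp, meson conversep.intros converse_rtranclp_into_rtranclp)
  qed
  moreover have "u = v"
    if "(step P E)\<^sup>*\<^sup>* e u \<and> normal P E u" "(step P E)\<^sup>*\<^sup>* e v \<and> normal P E v" for u v
  proof -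
    from that wt P4 obtain d where "(step P E)\<^sup>*\<^sup>* u d" "(step P E)\<^sup>*\<^sup>* v d"
      unfolding confluence_def by blast
    with that show ?thesis unfolding normal_def by (metis converse_rtranclpE)
  qed
  ultimately have "\<exists>!u. (step P E)\<^sup>*\<^sup>* e u \<and> normal P E u" by blast
  then show ?thesis unfolding nf_def by (rule theI')
qed

end

lemma nf_normal: "normal P E t \<Longrightarrow> nf P E t = t"
  unfolding nf_def by (rule the_equality) (auto simp: normal_def elim: converse_rtranclpE)

lemma normal_atom:
  fixes P :: "('v::infinite, 's) gpts"
  assumes "ok P E" "t = Sort s \<or> (t = Var x \<and> x \<notin> rew_names E)"
  shows "normal P E t"
  unfolding normal_def
proof
  assume "\<exists>u. step P E t u"
  then obtain u where "step P E t u" ..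
  then show False
  proof (cases rule: step.cases)
    case (st_rew \<Gamma> R \<Delta> l r \<delta>)
    then have "\<exists>f\<in>rew_names E. head (subst \<delta> l) = Var f"
      using rew_step_head[OF assms(1) st_rew(3,4), of \<delta>] by blast
    with st_rew(1) assms(2) show False by auto
  qed (use assms(2) in auto)
qed

lemma step_apps: "step P E a a' \<Longrightarrow> step P E (apps a es) (apps a' es)"
  by (induction es arbitrary: a a') (auto intro: st_app1)

lemma step_apps_arg: "step P E b b' \<Longrightarrow> step P E (apps a (bs @ b # es)) (apps a (bs @ b' # es))"
  by (auto intro: step_apps st_app2)

lemma normal_apps:
  assumes "normal P E (apps a es)"
  shows "normal P E a" "b \<in> set es \<Longrightarrow> normal P E b"
proof -
  show "normal P E a" using assms step_apps unfolding normal_def by blast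
  assume "b \<in> set es"
  then obtain bs cs where "es = bs @ b # cs" by (blast dest: split_list)
  with assms show "normal P E b" using step_apps_arg unfolding normal_def by blast
qed

text \<open>Strips the final conversions from the derivation and returns to the sort assigned by the
  formation rule; this type is rigid.\<close>

lemma typing_Sort_or_Pi:
  "typing P E e t \<Longrightarrow> (\<exists>s. e = Sort s) \<or> (\<exists>A B. e = Pi A B) \<Longrightarrow> \<exists>s. typing P E e (Sort s)"
proof (induction rule: typing_induct)
  case (sort E s1 s2)
  then show ?case by (blast intro: ty_sort)
next
  case (pi E A s1 L B s2 s3)
  then have "typing P E (Pi A B) (Sort s3)" by (intro ty_pi)
  then show ?case by blast
qed auto

lemma typing_Lam: "typing P E e t \<Longrightarrow> e = Lam A b \<Longrightarrow> \<exists>B. typing P E e (Pi A B)"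
proof (induction rule: typing_induct)
  case (lam E A' B s L b')
  then have "typing P E (Lam A' b') (Pi A' B)" by (intro ty_lam)
  with lam.prems show ?case by blast
qed auto

lemma rigid_cong: "head a = head b \<Longrightarrow> rigid E a \<longleftrightarrow> rigid E b"
  by (simp add: rigid_def)

lemma names_telescope: "length xs = arity T \<Longrightarrow> names (telescope xs T) = set xs"
  by (induction xs T rule: telescope.induct) auto

section \<open>Canonicity of normal terms\<close>

context standing
begin

text \<open>By uniqueness and confluence \<open>T\<close> reduces to the normal form of
  \<open>t\<close>, which therefore keeps the head of \<open>T\<close> or is a product. An untyped
  top sort \<open>t\<close> is out of reach of \<open>typed_nf\<close> and is treated apart.\<close>

lemma not_inductive_app:
  assumes "typing P E e t" "typing P E e T" and T: "(\<exists>s. head T = Sort s) \<or> (\<exists>A B. T = Pi A B)"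
  shows "\<not> inductive_app E (nf P E t)"
proof -
  have ok: "ok P E" using assms(1) by (rule typing_ok)
  from type_correctness[OF assms(1)] show ?thesis
  proof
    assume "\<exists>s. t = Sort s"
    then obtain s where "t = Sort s" ..
    moreover have "nf P E (Sort s) = Sort s" using ok by (intro nf_normal normal_atom) auto
    ultimately show ?thesis by (simp add: inductive_app_def)
  next
    assume "\<exists>s. typing P E t (Sort s)"
    then obtain s where t: "typing P E t (Sort s)" ..
    note nf = typed_nf[OF t]
    have "conv P E T t" using P2 assms(1,2) unfolding uniqueness_of_types_def by blast
    then obtain d where d: "(step P E)\<^sup>*\<^sup>* T d" "(step P E)\<^sup>*\<^sup>* t d"
      using conv_joinable by blast
    from nf d(2) P4 t obtain u where "(step P E)\<^sup>*\<^sup>* d u" "(step P E)\<^sup>*\<^sup>* (nf P E t) u"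
      unfolding confluence_def well_typed_def by blast
    moreover from this have "u = nf P E t" using nf unfolding normal_def by (metis converse_rtranclpE)
    ultimately have steps: "(step P E)\<^sup>*\<^sup>* T (nf P E t)" using d(1) by simp
    from T show ?thesis
    proof
      assume "\<exists>s. head T = Sort s"
      moreover from this have "rigid E T" by (simp add: rigid_def)
      ultimately show ?thesis using steps_rigid[OF steps ok] by (auto simp: inductive_app_def)
    next
      assume "\<exists>A B. T = Pi A B"
      then show ?thesis using steps_Pi steps ok by (fastforce simp: inductive_app_def)
    qed
  qed
qed

text \<open>Each argument consumes a product, as a term of rigid type cannot be applied, and
  instantiating the codomain preserves a rigid target head.\<close>

lemma spine_target:
  assumes "typing P E a T" "rigid E (target T)" "well_typed P E (apps a es)"
  shows "\<exists>T'. typing P E (apps a es) T' \<and> head (target T') = head (target T)"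
  using assms
proof (induction es arbitrary: a T)
  case (Cons b es)
  have wt: "well_typed P E (App a b)" using Cons.prems(3) well_typed_apps by simp
  then have "\<not> rigid E T" using App_not_rigid Cons.prems(1) by blast
  then obtain A B where T: "T = Pi A B" using Cons.prems(2) by (cases T) auto
  then have b: "typing P E (App a b) (inst B b)" using typing_App Cons.prems(1) wt by blast
  have head: "head (target (inst B b)) = head (target T)"
    using Cons.prems(2) T by (auto simp: rigid_def target_open)
  with Cons.prems(2) have "rigid E (target (inst B b))" using rigid_cong by metis
  with Cons.IH[OF b] Cons.prems(3) head show ?case by simp
qed auto

text \<open>Instantiating a codomain never lowers its arity, so a product is left after every
  argument.\<close>

lemma spine_partial:
  assumes "typing P E a T" "length es < arity T" "well_typed P E (apps a es)"
  shows "\<exists>A B. typing P E (apps a es) (Pi A B)"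
  using assms
proof (induction es arbitrary: a T)
  case Nil
  then show ?case by (cases T) auto
next
  case (Cons b es)
  then obtain A B where T: "T = Pi A B" by (cases T) auto
  have "well_typed P E (App a b)" using Cons.prems(3) well_typed_apps by simp
  then have "typing P E (App a b) (inst B b)" using typing_App Cons.prems(1) T by blast
  moreover have "length es < arity (inst B b)"
    using Cons.prems(2) T arity_open[of B 0 b] by simp
  ultimately show ?case using Cons.IH Cons.prems(3) by simp
qed

text \<open>Opening with the name \<open>y\<close> and then applying \<open>\<delta>\<close> equals
  opening with the argument \<open>\<delta> y\<close>. So the types that the spine requires of its
  arguments are the telescope types under \<open>\<delta>\<close>.\<close>

lemma spine_telescope:
  assumes "typing P E a (subst \<delta> T)" "length xs = arity T" "well_typed P E (apps a (map \<delta> xs))"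
    and "\<And>x. lc_at 0 (\<delta> x)" "(x, t) \<in> set (telescope xs T)"
  shows "typing P E (\<delta> x) (subst \<delta> t)"
  using assms
proof (induction xs arbitrary: a T)
  case (Cons y xs)
  then obtain A B where T: "T = Pi A B" by (cases T) auto
  have "well_typed P E (App a (\<delta> y))" using Cons.prems(3) well_typed_apps by simp
  then have y: "typing P E (\<delta> y) (subst \<delta> A)"
    and "typing P E (App a (\<delta> y)) (inst (subst \<delta> B) (\<delta> y))"
    using typing_App Cons.prems(1) T by auto
  moreover have "subst \<delta> (inst B (Var y)) = inst (subst \<delta> B) (\<delta> y)"
    using Cons.prems(4) by (subst subst_open_at) auto
  ultimately have "typing P E (App a (\<delta> y)) (subst \<delta> (inst B (Var y)))" by simp
  then have "(x, t) \<in> set (telescope xs (inst B (Var y))) \<Longrightarrow> ?case"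
    using Cons.IH[of "App a (\<delta> y)" "inst B (Var y)"] Cons.prems(2-4) T by simp
  with Cons.prems(5) y T show ?case by auto
qed simp

text \<open>The arguments exactly fill the telescope of the goal for \<open>f\<close>. Being typed
  and canonical, they form a canonical substitution; being normal, they are their own normal forms,
  so the instance is the given term itself.\<close>

lemma rew_not_normal:
  assumes closed: "complete_rew P E1 \<Gamma> R" and E: "E = E1 @ [Rew \<Gamma> R] @ E2" and ok: "ok P E"
    and f: "(f, T) \<in> set \<Gamma>" and len: "length ds = arity T"
    and wt: "well_typed P E (apps (Var f) ds)"
    and can: "\<And>d t. d \<in> set ds \<Longrightarrow> typing P E d t \<Longrightarrow> normal P E d \<and> canonical P E d t"
  shows "\<not> normal P E (apps (Var f) ds)"
proof -
  \<comment> \<open>The telescope names avoid all of \<open>E\<close>, not just \<open>E1\<close>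
    and \<open>\<Gamma>\<close>, so that the substitution below fixes the declared type
    \<open>T\<close>.\<close>
  have "infinite (- env_names E)" using infinite_UNIV finite_env_names by (simp add: Compl_eq_Diff_UNIV)
  then obtain X where X: "finite X" "card X = length ds" "X \<subseteq> - env_names E"
    using infinite_arbitrarily_large by metis
  then obtain xs where xs: "set xs = X" "distinct xs" using finite_distinct_list by metis
  with X(2) have len_xs: "length xs = length ds" using distinct_card by metis
  define \<delta> where "\<delta> x = (case map_of (zip xs ds) x of None \<Rightarrow> Var x | Some d \<Rightarrow> d)" for x
  have "\<delta> (xs ! i) = ds ! i" if "i < length ds" for i
    using that len_xs xs(2) by (simp add: \<delta>_def map_of_zip_nth)
  then have map: "map \<delta> xs = ds" using len_xs by (intro nth_equalityI) auto
  have out: "\<delta> x = Var x" if "x \<notin> set xs" for x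
  proof -
    have "map_of (zip xs ds) x = None" using that len_xs by simp
    then show ?thesis by (simp add: \<delta>_def)
  qed
  have typed: "\<exists>t. typing P E d t" if "d \<in> set ds" for d
    using well_typed_apps_arg wt that unfolding well_typed_def by blast
  have lc: "lc_at 0 (\<delta> x)" for x
  proof (cases "x \<in> set xs")
    case True
    then have "\<delta> x \<in> set ds" using map by force
    then show ?thesis using typed typing_lc by blast
  qed (simp add: out)
  have decl: "Rew \<Gamma> R \<in> set E" "(f, T) \<in> set (declared (Rew \<Gamma> R))" using E f by auto
  have "subst \<delta> T = T" using ok_declared_fv[OF ok decl] xs X(3) by (intro subst_id out) auto
  then have "typing P E (Var f) (subst \<delta> T)" using ok decl by (auto intro: ty_name)
  then have tele: "typing P E (\<delta> x) (subst \<delta> t)" if "(x, t) \<in> set (telescope xs T)" for x t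
    using spine_telescope[of E "Var f" \<delta> T xs x t] that lc len len_xs wt map by simp
  have names: "names (telescope xs T) = set xs" using len len_xs by (intro names_telescope) simp
  have "canonical P E (\<delta> x) (subst \<delta> t)" if xt: "(x, t) \<in> set (telescope xs T)" for x t
  proof -
    have "x \<in> set xs" using xt names by force
    then have "\<delta> x \<in> set ds" using map by force
    then show ?thesis using can tele[OF xt] by blast
  qed
  then have "canonical_subst P E (telescope xs T) \<delta>"
    using tele names out unfolding canonical_subst_def wt_subst_def by blast
  moreover have "map (\<lambda>a. nf P E (subst \<delta> a)) (map Var xs) = ds"
  proof -
    have "map (\<lambda>a. nf P E (subst \<delta> a)) (map Var xs) = map (nf P E) (map \<delta> xs)" by simp
    also have "\<dots> = ds" unfolding map
      using typed can nf_normal by (metis map_idI)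
    finally show ?thesis .
  qed
  ultimately have inst: "normalized_canonical_instance P E1 \<Gamma> R (telescope xs T) f (map Var xs) E2
      (apps (Var f) ds)"
    using wt unfolding normalized_canonical_instance_def Let_def E by metis
  have "set xs \<inter> (env_names E1 \<union> names \<Gamma>) = {}" using X(3) xs(1) E by auto
  then have "covered P E1 \<Gamma> R (telescope xs T) f (map Var xs)"
    using closed f xs(2) len len_xs unfolding complete_rew_def by fastforce
  with inst have "immediately_covered P E R (apps (Var f) ds)"
    unfolding covered_def E by blast
  then obtain \<Delta> l r \<gamma> where "(\<Delta>, l, r) \<in> R" "wt_subst P E \<Delta> \<gamma>" "subst \<gamma> l = apps (Var f) ds"
    unfolding immediately_covered_def by blast
  \<comment> \<open>The matching substitution is well typed, which is the side condition of a
    rewrite step.\<close>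
  then have "step P E (apps (Var f) ds) (subst \<gamma> r)"
    using st_rew[of \<Gamma> R E \<Delta> l r P \<gamma>] decl(1) unfolding wt_subst_def by fastforce
  then show ?thesis unfolding normal_def by blast
qed

lemma ok_Ind_target:
  assumes ok: "ok P E" and Ind: "Ind \<Gamma>I \<Gamma>C \<in> set E" and x: "(x, T) \<in> set (\<Gamma>I @ \<Gamma>C)"
  shows "((x, T) \<in> set \<Gamma>I \<and> (\<exists>s. head (target T) = Sort s)) \<or>
    ((x, T) \<in> set \<Gamma>C \<and> (\<exists>I\<in>names \<Gamma>I. I \<notin> rew_names E \<and> head (target T) = Var I))"
proof -
  have "I \<notin> rew_names E" if "I \<in> names \<Gamma>I" for I
    using Ind_not_rew_name[OF ok Ind] that by auto
  with ok_Ind[OF ok Ind] x show ?thesis by fastforce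
qed

text \<open>Ranges over all types of a term: below a function symbol an argument is needed at its
  telescope type, below a constructor at any type it has.\<close>

lemma normal_canonical:
  assumes closed: "closed_env P E"
  shows "typing P E e t \<Longrightarrow> normal P E e \<Longrightarrow> canonical P E e t"
proof (induction "size e" arbitrary: e t rule: less_induct)
  case less
  have ok: "ok P E" using less.prems(1) by (rule typing_ok)
  obtain es where e: "e = apps (head e) es" using apps_head by blast
  have wt: "well_typed P E (apps (head e) es)" using less.prems(1) e unfolding well_typed_def by metis
  have wt_h: "well_typed P E (head e)" using wt by (rule well_typed_apps)
  have can: "normal P E d \<and> canonical P E d u" if "d \<in> set es" "typing P E d u" for d u
    using less.hyps[of d u] normal_apps(2)[of P E "head e" es d] size_arg[of d es "head e"]
      less.prems(2) e that by metis
  have typed: "\<exists>t. typing P E d t" if "d \<in> set es" for d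
    using well_typed_apps_arg wt that unfolding well_typed_def by blast
  show ?case
  proof (cases "inductive_app E (nf P E t)")
    case False
    with less.prems(1) show ?thesis by (rule canonical_other)
  next
    case ind: True
    have no: False if "typing P E e T" "(\<exists>s. head T = Sort s) \<or> (\<exists>A B. T = Pi A B)" for T
      using not_inductive_app[OF less.prems(1) that] ind by blast
    show ?thesis
    proof (cases "head e")
      case (App a b)
      then show ?thesis using head_not_App by metis
    next
      case (Bound i)
      with wt_h typing_generation show ?thesis unfolding well_typed_def by fastforce
    next
      case (Lam A b)
      then obtain B where B: "typing P E (head e) (Pi A B)"
        using wt_h typing_Lam unfolding well_typed_def by blast
      show ?thesis
      proof (cases es)
        case Nil
        with e B no show ?thesis by force
      next
        case (Cons d ds)
        then have "step P E e (apps (inst b d) ds)" using e Lam by (metis foldl_Cons st_beta step_apps)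
        with less.prems(2) show ?thesis unfolding normal_def by blast
      qed
    next
      case (Var x)
      then obtain u where "typing P E (Var x) u" using wt_h unfolding well_typed_def by auto
      then obtain d T where d: "d \<in> set E" "(x, T) \<in> set (declared d)"
        using typing_generation by fastforce
      then have T: "typing P E (Var x) T" using ok by (blast intro: ty_name)
      have wt_x: "well_typed P E (apps (Var x) es)" using wt Var by simp
      have e_x: "e = apps (Var x) es" using e Var by simp
      show ?thesis
      proof (cases d)
        case (VarD y u)
        with d(1) closed show ?thesis unfolding closed_env_def by blast
      next
        case (Ind \<Gamma>I \<Gamma>C)
        with d ok_Ind_target[OF ok, of \<Gamma>I \<Gamma>C x T] consider
            (type) s where "head (target T) = Sort s" | (constr) "x \<in> names \<Gamma>C"
          by force
        then show ?thesis
        proof cases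
          case type
          then obtain T' where "typing P E e T'" "head (target T') = Sort s"
            using spine_target[OF T _ wt_x] e_x unfolding rigid_def by auto
          \<comment> \<open>\<open>T'\<close> is still a product if the inductive type lacks
            arguments.\<close>
          moreover from this have "(\<exists>s. head T' = Sort s) \<or> (\<exists>A B. T' = Pi A B)" by (cases T') auto
          ultimately show ?thesis using no by blast
        next
          case constr
          then have "x \<in> constructors E" using d(1) Ind unfolding constructors_def by blast
          then have "canonical P E (apps (Var x) es) t"
            using less.prems(1) e_x ind can typed by (intro canonical_constructor) blast+
          then show ?thesis using e_x by simp
        qed
      next
        case (Rew \<Gamma> R)
        obtain E1 E2 where E: "E = E1 @ [Rew \<Gamma> R] @ E2"
          using d(1) Rew by (auto dest: split_list)
        show ?thesis
        proof (cases "length es < arity T")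
          case True
          with spine_partial[OF T _ wt_x] no e_x show ?thesis by blast
        next
          case False
          \<comment> \<open>There may be more arguments than the declared arity, as for
            \<open>f : \<Pi>A:\<star>. A\<close>, where instantiation can create new products. The
            prefix of declared length is already reducible.\<close>
          let ?ds = "take (arity T) es"
          have split: "apps (apps (Var x) ?ds) (drop (arity T) es) = e"
            using e_x by (simp flip: foldl_append)
          have "\<not> normal P E (apps (Var x) ?ds)"
          proof (rule rew_not_normal[OF _ E ok])
            show "complete_rew P E1 \<Gamma> R" using closed E unfolding closed_env_def by blast
            show "(x, T) \<in> set \<Gamma>" using d(2) Rew by simp
            show "length ?ds = arity T" using False by simp
            show "well_typed P E (apps (Var x) ?ds)"
              using well_typed_apps split less.prems(1) unfolding well_typed_def by metis
          qed (use can set_take_subset in fast)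
          then show ?thesis using normal_apps(1) split less.prems(2) by metis
        qed
      qed
    next
      case (Sort s)
      then obtain s' where s': "typing P E (head e) (Sort s')"
        using wt_h typing_Sort_or_Pi unfolding well_typed_def by blast
      \<comment> \<open>A term whose type is a sort cannot be applied.\<close>
      then have "es = []" using App_not_rigid[OF s'] wt
        by (cases es) (auto simp: rigid_def dest: well_typed_apps)
      with s' e no show ?thesis by force
    next
      case (Pi A B)
      then obtain s' where s': "typing P E (head e) (Sort s')"
        using wt_h typing_Sort_or_Pi unfolding well_typed_def by blast
      then have "es = []" using App_not_rigid[OF s'] wt
        by (cases es) (auto simp: rigid_def dest: well_typed_apps)
      with s' e no show ?thesis by force
    qed
  qed
qed

section \<open>Consistency by adding an empty inductive type\<close>

lemma closed_env_extend_Ind: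
  assumes "closed_env P E"
  shows "closed_env P (E @ [Ind \<Gamma>I \<Gamma>C])"
  unfolding closed_env_def
proof (intro conjI allI impI)
  show "\<forall>d\<in>set (E @ [Ind \<Gamma>I \<Gamma>C]). \<nexists>x t. d = VarD x t"
    using assms unfolding closed_env_def by auto
  fix E1 \<Gamma> R E2 assume *: "E @ [Ind \<Gamma>I \<Gamma>C] = E1 @ [Rew \<Gamma> R] @ E2"
  \<comment> \<open>The new declaration is inductive, so it is the last entry of \<open>E2\<close>;
    completeness depends only on the part \<open>E1\<close> before the definition.\<close>
  then have "E = E1 @ [Rew \<Gamma> R] @ butlast E2"
    by (cases E2 rule: rev_cases) (auto simp flip: append_assoc append_Cons)
  then show "complete_rew P E1 \<Gamma> R" using assms unfolding closed_env_def by blast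
qed

text \<open>A constructor at the head of the normal form would build some type \<open>I\<close>.
  Convertibility of rigid types forces \<open>I = N\<close>, and since \<open>N\<close> is declared
  only once, its list of constructors is the empty one.\<close>

lemma empty_inductive_type_uninhabited:
  assumes closed: "closed_env P E" and Ind: "Ind [(N, Sort s)] [] \<in> set E"
  shows "\<not> typing P E e (Var N)"
proof
  assume e: "typing P E e (Var N)"
  have ok: "ok P E" using e by (rule typing_ok)
  define e' where "e' = nf P E e"
  have e': "typing P E e' (Var N)" "normal P E e'"
    using typed_nf[OF e] steps_typing[OF _ e] unfolding e'_def by auto
  have N: "N \<notin> rew_names E" using Ind_not_rew_name[OF ok Ind] by simp
  have "N \<in> inductive_types E" using Ind unfolding inductive_types_def by force
  moreover have "nf P E (Var N) = Var N" using ok N by (intro nf_normal normal_atom) auto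
  ultimately have "inductive_app E (nf P E (Var N))" by (simp add: inductive_app_def)
  with normal_canonical[OF closed e'] obtain c es where c: "c \<in> constructors E" "e' = apps (Var c) es"
    by (auto elim: canonical.cases)
  then obtain \<Gamma>I \<Gamma>C T where C: "Ind \<Gamma>I \<Gamma>C \<in> set E" "(c, T) \<in> set \<Gamma>C"
    unfolding constructors_def by auto
  from ok_Ind[OF ok C(1)] C(2) obtain I where I: "I \<in> names \<Gamma>I" "head (target T) = Var I" by fast
  have "I \<notin> rew_names E" using Ind_not_rew_name[OF ok C(1)] I(1) by auto
  then have rigid: "rigid E (target T)" using I(2) by (simp add: rigid_def)
  have T: "typing P E (Var c) T" using ok C by (intro ty_name[of _ _ "Ind \<Gamma>I \<Gamma>C"]) auto
  obtain T' where T': "typing P E e' T'" "head (target T') = Var I"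
    using spine_target[OF T rigid, of es] e'(1) c(2) I(2) unfolding well_typed_def by metis
  have conv: "conv P E T' (Var N)" using P2 T'(1) e'(1) unfolding uniqueness_of_types_def by blast
  have rigid_N: "rigid E (Var N)" using N by (simp add: rigid_def)
  \<comment> \<open>So the constructor is fully applied, and the target of \<open>T'\<close> is
    \<open>T'\<close> itself.\<close>
  have "\<nexists>A B. T' = Pi A B" using conv conv_Pi_not_rigid[OF _ ok] rigid_N by blast
  then have "head T' = Var I" using T'(2) by (cases T') auto
  moreover have "rigid E T'" using calculation \<open>I \<notin> rew_names E\<close> by (simp add: rigid_def)
  ultimately have "I = N" using conv_rigid[OF conv ok _ rigid_N] by simp
  with I(1) have "N \<in> names (declared (Ind \<Gamma>I \<Gamma>C))" by auto
  with ok_same_decl[OF ok Ind C(1), of N] have "\<Gamma>C = []" by simp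
  with C(2) show False by simp
qed

end

theorem theorem4p7:
  fixes P :: "('v::infinite, 's) gpts" and E :: "('v, 's) env" and star box :: 's
  assumes star_box: "(star, box) \<in> sort_axioms P"
    and pos_False: "\<And>E0 False_name. ok P E0 \<Longrightarrow> False_name \<notin> env_names E0 \<Longrightarrow>
                      pos P E0 [(False_name, Sort star)] []"
    and P1: "subject_reduction P"
    and P2: "uniqueness_of_types P"
    and P3: "strong_normalization P"
    and P4: "confluence P"
    and closed: "closed_env P E"
  shows "consistent P star E"
  unfolding consistent_def
proof
  interpret standing P using P1 P2 P3 P4 by unfold_locales
  assume "\<exists>e. typing P E e (Pi (Sort star) (Bound 0))"
  then obtain e where e: "typing P E e (Pi (Sort star) (Bound 0))" ..
  have ok: "ok P E" using e by (rule typing_ok)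
  obtain N where N: "N \<notin> env_names E"
    by (metis ex_new_if_finite infinite_UNIV finite_env_names)
  let ?F = "E @ [Ind [(N, Sort star)] []]"
  \<comment> \<open>\<open>ok_ind\<close> starts from the declared names as plain variables.\<close>
  have "ok P (E @ [VarD N (Sort star)])" using ok star_box N by (intro ok_var ty_sort)
  then have ok_F: "ok P ?F" using pos_False[OF ok N] by (intro ok_ind) auto
  then have "typing P ?F e (Pi (Sort star) (Bound 0))"
    using typing_weaken[OF e] weakens_append by blast
  moreover have "typing P ?F (Var N) (Sort star)"
    using ok_F by (intro ty_name[of _ _ "Ind [(N, Sort star)] []"]) auto
  ultimately have "typing P ?F (App e (Var N)) (inst (Bound 0) (Var N))" by (rule ty_app)
  then show False
    using empty_inductive_type_uninhabited[OF closed_env_extend_Ind[OF closed], of N star] by simp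
qed

end
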